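(* Let $n\ge2$ be an integer and suppose that the shifted Lonely Runner Conjecture (sLRC) holds for $n-1$ velocities. Let $v_1,\dots,v_n$ be pairwise distinct positive integers with $\gcd(v_1,\dots,v_n)=1$ that satisfy one of the following conditions: (1) some $n-1$ of the velocities $v_1,\dots,v_n$ have a common factor greater than $1$; (2) $n\ge 3$ and, for some $n-2$ of the velocities, their greatest common divisor $\delta$ satisfies $\delta\notin\{1,2,4\}$; moreover, if $n\ge7$, then $\delta\notin\{1,2\}$ suffices. Then sLRC holds for $(v_1,\dots,v_n)$, i.e. for every $s_1,\dots,s_n\in\mathbb{R}$ there is some $t\in\mathbb{R}$ such that $\|v_it+s_i\|\ge\frac1{n+1}$ for all $1\le i\le n$.
   Context: For $x\in\mathbb{R}$, $\|x\|$ denotes the distance from $x$ to a nearest integer. "sLRC holds for $m$ velocities" means: for all pairwise distinct positive real numbers $w_1,\dots,w_m$ and all $s_1,\dots,s_m\in\mathbb{R}$ there is some $t\in\mathbb{R}$ with $\|w_it+s_i\|\ge\frac1{m+1}$ for all $1\le i\le m$. *)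

theory Defs
  imports Complex_Main
begin

definition dist_nearest_int :: "real \<Rightarrow> real" where
  "dist_nearest_int x = \<bar>x - of_int (round x)\<bar>"

text \<open>The shifted Lonely Runner property of one given tuple of velocities
  \<open>w 1, \<dots>, w m\<close>; values of \<open>w\<close> and \<open>s\<close> outside \<open>{1..m}\<close> are irrelevant.\<close>

definition sLRC_holds_for :: "nat \<Rightarrow> (nat \<Rightarrow> real) \<Rightarrow> bool" where
  "sLRC_holds_for m w \<longleftrightarrow>
    (\<forall>s :: nat \<Rightarrow> real. \<exists>t :: real. \<forall>i\<in>{1..m}.
       dist_nearest_int (w i * t + s i) \<ge> 1 / (real m + 1))"

definition sLRC :: "nat \<Rightarrow> bool" where
  "sLRC m \<longleftrightarrow>
    (\<forall>w :: nat \<Rightarrow> real. inj_on w {1..m} \<longrightarrow> (\<forall>i\<in>{1..m}. 0 < w i) \<longrightarrow> sLRC_holds_for m w)"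

end

theory Submission
  imports Defs
begin

text \<open>Let \<open>m\<close> divide all velocities except one or two. Replacing a good time \<open>t\<close> for the others
  by \<open>t + k / m\<close> leaves them fixed and moves an exceptional runner, whose velocity is coprime to
  \<open>m\<close>, through all translates by multiples of \<open>1 / m\<close>. An open arc of length \<open>2e\<close> contains more than
  \<open>j\<close> of these \<open>m\<close> points only if \<open>m\<close> times the position lies within \<open>e m - j / 2\<close> of the coset
  \<open>j / 2 + \<int>\<close>; so few \<open>k\<close> are bad, and for \<open>n \<ge> 5\<close> counting bad \<open>k\<close> suffices.

  For \<open>n = 3\<close> counting fails by one. With pairwise coprime velocities one takes \<open>m\<close> to be an even
  velocity or, if all are odd, the largest one, tunes \<open>t\<close>, and follows the third runner
  along a run of consecutive good positions of the second.

  For \<open>n = 4\<close> counting settles all odd \<open>m \<ge> 5\<close>. For even \<open>m \<ge> 6\<close>, the hypothesis applied to the two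
  multiples of \<open>m\<close> and a third velocity lowers the count of one exceptional runner by one. For \<open>m = 3\<close>,
  after a change of sign the two exceptional runners are rotated by the same multiple of \<open>1 / 3\<close>,
  so their difference is unaffected, and the hypothesis can be used to control that difference;
  if it moves with one of the two common velocities, a direct analysis is needed.\<close>

notation dist_nearest_int ("\<parallel>_\<parallel>")

section \<open>Distance to the nearest integer\<close>

lemma dist_nearest_int_le: "\<parallel>x\<parallel> \<le> \<bar>x - of_int k\<bar>"
  using round_diff_minimal[of x k] by (simp add: dist_nearest_int_def)

lemma dist_nearest_int_geI: "(\<And>k::int. e \<le> \<bar>x - of_int k\<bar>) \<Longrightarrow> e \<le> \<parallel>x\<parallel>"
  by (simp add: dist_nearest_int_def)

lemma dist_nearest_int_less_iff: "\<parallel>x\<parallel> < e \<longleftrightarrow> (\<exists>k::int. \<bar>x - of_int k\<bar> < e)"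
  using dist_nearest_int_le[of x] by (metis dist_nearest_int_def le_less_trans)

lemma dist_nearest_int_nonneg [simp]: "0 \<le> \<parallel>x\<parallel>"
  by (simp add: dist_nearest_int_def)

lemma dist_nearest_int_add_int [simp]: "\<parallel>x + of_int k\<parallel> = \<parallel>x\<parallel>"
proof -
  have *: "\<parallel>y + of_int j\<parallel> \<le> \<parallel>y\<parallel>" for y j
    using dist_nearest_int_le[of "y + of_int j" "round y + j"] by (simp add: dist_nearest_int_def)
  show ?thesis using *[of x k] *[of "x + of_int k" "- k"] by simp
qed

lemma dist_nearest_int_eqI: "y = x + of_int k \<Longrightarrow> \<parallel>y\<parallel> = \<parallel>x\<parallel>"
  by simp

lemma dist_nearest_int_minus [simp]: "\<parallel>- x\<parallel> = \<parallel>x\<parallel>"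
proof -
  have *: "\<parallel>- y\<parallel> \<le> \<parallel>y\<parallel>" for y
    using dist_nearest_int_le[of "- y" "- round y"] by (simp add: dist_nearest_int_def)
  show ?thesis using *[of x] *[of "- x"] by simp
qed

lemma dist_nearest_int_triangle: "\<parallel>x + y\<parallel> \<le> \<parallel>x\<parallel> + \<parallel>y\<parallel>"
  using dist_nearest_int_le[of "x + y" "round x + round y"] by (simp add: dist_nearest_int_def)

lemma dist_nearest_int_ge_between:
  assumes "of_int k + e \<le> x" "x \<le> of_int k + 1 - e"
  shows "e \<le> \<parallel>x\<parallel>"
proof (rule dist_nearest_int_geI)
  fix j :: int
  show "e \<le> \<bar>x - of_int j\<bar>"
  proof (cases "j \<le> k")
    case True
    then have "real_of_int j \<le> of_int k" by simp
    then show ?thesis using assms by linarith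
  next
    case False
    then have "real_of_int j \<ge> of_int k + 1" by linarith
    then show ?thesis using assms by linarith
  qed
qed

lemma dist_nearest_int_floor_bounds:
  assumes "e \<le> \<parallel>x\<parallel>"
  shows "of_int \<lfloor>x\<rfloor> + e \<le> x" "x \<le> of_int \<lfloor>x\<rfloor> + 1 - e"
  using dist_nearest_int_le[of x "\<lfloor>x\<rfloor>"] dist_nearest_int_le[of x "\<lfloor>x\<rfloor> + 1"] assms
    floor_correct[of x] by (simp_all add: abs_if split: if_splits)

lemma not_both_near_int:
  assumes "2 * e \<le> y - x" "y - x \<le> 1 - 2 * e"
  shows "e \<le> \<parallel>x\<parallel> \<or> e \<le> \<parallel>y\<parallel>"
proof -
  have "2 * e \<le> \<parallel>y - x\<parallel>"
    using assms by (intro dist_nearest_int_ge_between[of 0]) auto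
  also have "\<parallel>y - x\<parallel> \<le> \<parallel>y\<parallel> + \<parallel>x\<parallel>"
    using dist_nearest_int_triangle[of y "- x"] by simp
  finally show ?thesis by linarith
qed

text \<open>The bad \<open>u\<close> form open intervals of length \<open>2 * e / r\<close>,
  disjoint because \<open>e <= 1/2\<close>. A closed interval at least that long does not fit inside
  one of them.\<close>

lemma ex_far_in_interval:
  fixes r s :: real
  assumes "0 < r" "2 * e \<le> r * (hi - lo)" "e \<le> 1/2" "0 < e"
  shows "\<exists>u\<ge>lo. u \<le> hi \<and> e \<le> \<parallel>r * u + s\<parallel>"
proof (cases "e \<le> \<parallel>r * lo + s\<parallel>")
  case True
  have "0 \<le> r * (hi - lo)" using assms by linarith
  then have "lo \<le> hi" using assms(1) by (simp add: zero_le_mult_iff)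
  then show ?thesis using True by auto
next
  case False
  then obtain j :: int where j: "\<bar>r * lo + s - of_int j\<bar> < e"
    by (auto simp: not_le dist_nearest_int_less_iff)
  \<comment> \<open>\<open>u\<close> is the time at which the bad arc around \<open>j\<close> is
    left.\<close>
  define u where "u = (of_int j + e - s) / r"
  have u: "r * u + s = of_int j + e" using assms(1) by (simp add: u_def)
  have "r * lo \<le> r * u" using u j by linarith
  moreover have "r * u \<le> r * hi" using u j assms(2) by (simp add: algebra_simps abs_if split: if_splits)
  moreover have "e \<le> \<parallel>r * u + s\<parallel>"
    unfolding u by (rule dist_nearest_int_ge_between[of j]) (use assms in auto)
  ultimately show ?thesis using assms(1) by (auto intro!: exI[of _ u])
qed

text \<open>In the phase \<open>r * u + s\<close> consecutive bad arcs are \<open>1 - 2 * e\<close>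
  apart, so the window meets at most one of them. Deleting it leaves at most two pieces of total
  length at least \<open>r * L - 2 * e\<close>, and the longer one has at least half of
  that.\<close>

lemma ex_far_subinterval:
  fixes r s :: real
  assumes r: "0 < r" and e: "0 < e" and L: "2 * e \<le> r * L" "r * L \<le> 1 - 2 * e"
  shows "\<exists>lo\<ge>p. lo + (L - 2 * e / r) / 2 \<le> p + L \<and>
    (\<forall>u. lo \<le> u \<longrightarrow> u \<le> lo + (L - 2 * e / r) / 2 \<longrightarrow> e \<le> \<parallel>r * u + s\<parallel>)"
proof -
  define h where "h = (r * L - 2 * e) / 2"
  have hr: "(L - 2 * e / r) / 2 = h / r" using r by (simp add: h_def field_simps)
  have h: "0 \<le> h" "2 * h = r * L - 2 * e" using L by (simp_all add: h_def)
  define f where "f = r * p + s"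
  \<comment> \<open>The period of the initial phase \<open>f\<close> is taken from the left end of
    the bad arc around \<open>k\<close>. The three cases are: start inside that arc, enough good
    room at once, or a jump past the arc around \<open>k + 1\<close>.\<close>
  define k where "k = \<lfloor>f + e\<rfloor>"
  have k: "of_int k - e \<le> f" "f < of_int k + 1 - e"
    unfolding k_def using floor_correct[of "f + e"] by linarith+
  have main: ?thesis if g: "f \<le> g" "g + h \<le> f + r * L" "of_int j + e \<le> g" "g + h \<le> of_int j + 1 - e"
    for g and j :: int
  proof (intro exI conjI allI impI)
    have rp: "r * ((g - s) / r) = g - s" using r by simp
    show "p \<le> (g - s) / r"
      using g(1) r by (simp add: f_def field_simps)
    show "(g - s) / r + (L - 2 * e / r) / 2 \<le> p + L"
      unfolding hr using g(2) r by (simp add: f_def field_simps)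
    fix u assume u: "(g - s) / r \<le> u" "u \<le> (g - s) / r + (L - 2 * e / r) / 2"
    from u(1) have "g \<le> r * u + s" using r by (simp add: field_simps)
    moreover from u(2) have "r * u + s \<le> g + h" unfolding hr using r by (simp add: field_simps)
    ultimately show "e \<le> \<parallel>r * u + s\<parallel>"
      using g(3,4) by (intro dist_nearest_int_ge_between[of j]) linarith+
  qed
  consider "f < of_int k + e" | "of_int k + e \<le> f" "f + h \<le> of_int k + 1 - e"
    | "of_int k + e \<le> f" "of_int k + 1 - e < f + h" by linarith
  then show ?thesis
  proof cases
    case 1
    show ?thesis by (rule main[of "of_int k + e" k]) (use 1 k h L e in linarith)+
  next
    case 2
    show ?thesis by (rule main[of f k]) (use 2 k h L e in linarith)+
  next
    case 3
    show ?thesis by (rule main[of "of_int k + 1 + e" "k + 1"]) (use 3 k h L e in auto)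
  qed
qed

section \<open>Rotating by multiples of a fraction\<close>

text \<open>Scaled by \<open>d\<close>, each near position gives an integer within
  \<open>e * d\<close> of \<open>- d * x\<close>, and coprimality makes these integers distinct. As
  \<open>m + 1\<close> of them span at least \<open>m\<close>, both extremes can be that close only
  if their surroundings are centred up to \<open>e * d - m / 2\<close>.\<close>

lemma many_near_imp_centre_near:
  fixes a d m :: nat and x e :: real
  assumes "coprime a d" "0 < d"
    and card: "m + 1 \<le> card {k\<in>{..<d}. \<parallel>x + real k * a / d\<parallel> < e}"
  shows "\<parallel>d * x + m / 2\<parallel> < e * d - m / 2"
proof -
  define B where "B = {k\<in>{..<d}. \<parallel>x + real k * a / d\<parallel> < e}"
  define j where "j k = int k * int a - int d * round (x + real k * a / d)" for k
  have near: "\<bar>d * x + of_int (j k)\<bar> < e * d" if "k \<in> B" for k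
  proof -
    have "\<bar>x + real k * a / d - of_int (round (x + real k * a / d))\<bar> < e"
      using that by (simp add: B_def dist_nearest_int_def)
    then have "\<bar>x + real k * a / d - of_int (round (x + real k * a / d))\<bar> * d < e * d"
      using assms(2) by simp
    also have "\<bar>x + real k * a / d - of_int (round (x + real k * a / d))\<bar> * d
      = \<bar>(x + real k * a / d - of_int (round (x + real k * a / d))) * d\<bar>"
      by (simp add: abs_mult)
    also have "(x + real k * a / d - of_int (round (x + real k * a / d))) * d = d * x + of_int (j k)"
      using assms(2) by (simp add: j_def field_simps)
    finally show ?thesis .
  qed
  have inj: "inj_on j B"
  proof (rule inj_onI)
    fix k l assume kl: "k \<in> B" "l \<in> B" "j k = j l"
    then have "int d * (round (x + real k * a / d) - round (x + real l * a / d)) = int a * (int k - int l)"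
      by (simp add: j_def algebra_simps)
    then have "int d dvd int a * (int k - int l)" by (metis dvd_triv_left)
    then have "int d dvd int k - int l"
      using assms(1) by (simp add: coprime_dvd_mult_right_iff coprime_commute)
    moreover have "\<bar>int k - int l\<bar> < int d" using kl(1,2) by (auto simp: B_def)
    ultimately show "k = l" using dvd_imp_le_int[of "int k - int l" "int d"] by linarith
  qed
  define S where "S = j ` B"
  have fin: "finite S" by (simp add: S_def B_def)
  have cS: "m + 1 \<le> card S" using card inj by (simp add: S_def card_image B_def)
  then have ne: "S \<noteq> {}" by auto
  have "S \<subseteq> {Min S..Max S}" using fin by auto
  then have "card S \<le> card {Min S..Max S}" by (intro card_mono) auto
  then have len: "real_of_int (Min S) + m \<le> of_int (Max S)" using cS by auto
  have "Min S \<in> S" "Max S \<in> S" using fin ne by auto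
  then have "\<bar>d * x + of_int (Min S)\<bar> < e * d" "\<bar>d * x + of_int (Max S)\<bar> < e * d"
    using near by (auto simp: S_def)
  then have "\<bar>(d * x + m / 2) - of_int (- Min S)\<bar> < e * d - m / 2"
    using len by (simp add: abs_if split: if_splits)
  then show ?thesis by (rule le_less_trans[OF dist_nearest_int_le])
qed

text \<open>This is the case \<open>m = d - 1\<close> of the counting: failure would make all
  \<open>d\<close> positions near.\<close>

lemma ex_far_rotation:
  fixes a d :: nat and x e :: real
  assumes "coprime a d" "0 < d" "e * d - (real d - 1) / 2 \<le> \<parallel>d * x + (real d - 1) / 2\<parallel>"
  shows "\<exists>k<d. e \<le> \<parallel>x + real k * a / d\<parallel>"
proof (rule ccontr)
  assume "\<not> ?thesis"
  then have "{k\<in>{..<d}. \<parallel>x + real k * a / d\<parallel> < e} = {..<d}" by auto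
  then have "(d - 1) + 1 \<le> card {k\<in>{..<d}. \<parallel>x + real k * a / d\<parallel> < e}" using assms(2) by simp
  from many_near_imp_centre_near[OF assms(1,2) this] show False
    using assms(2,3) by (simp add: of_nat_diff)
qed

lemma ex_far_rotation_quarter:
  fixes a d :: nat and x e :: real
  assumes "coprime a d" "2 \<le> d" "e \<le> 1 / 4"
  shows "\<exists>k<d. e \<le> \<parallel>x + real k * a / d\<parallel>"
proof -
  have ed: "e * d \<le> 1 / 4 * d" using assms by (intro mult_right_mono) auto
  have d: "2 \<le> real d" using assms(2) by simp
  have "p - (q - 1) / 2 \<le> 0" if "p \<le> 1 / 4 * q" "2 \<le> q" for p q :: real
    using that by (simp add: field_simps)
  \<comment> \<open>Since \<open>d / 4 <= (d - 1) / 2\<close> for \<open>d >= 2\<close>, the centre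
    condition holds for every \<open>x\<close>.\<close>
  from this[OF ed d] have "e * d - (real d - 1) / 2 \<le> 0" .
  then have "e * d - (real d - 1) / 2 \<le> \<parallel>z\<parallel>" for z
    by (rule order_trans) simp
  then show ?thesis
    using assms by (intro ex_far_rotation) simp_all
qed

text \<open>The centre conditions allow at most \<open>m\<close> bad rotations for one runner and
  \<open>l\<close> for the other, so one of the \<open>d\<close> rotations is good for both. Unequal
  \<open>m\<close> and \<open>l\<close> serve even \<open>d\<close>.\<close>

lemma ex_far_rotation_pair:
  fixes a b d m l :: nat and x y e :: real
  assumes "coprime a d" "coprime b d" "m + l < d"
    and "e * d - m / 2 \<le> \<parallel>d * x + m / 2\<parallel>" "e * d - l / 2 \<le> \<parallel>d * y + l / 2\<parallel>"
  shows "\<exists>k<d. e \<le> \<parallel>x + real k * a / d\<parallel> \<and> e \<le> \<parallel>y + real k * b / d\<parallel>"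
proof (rule ccontr)
  define A where "A = {k\<in>{..<d}. \<parallel>x + real k * a / d\<parallel> < e}"
  define B where "B = {k\<in>{..<d}. \<parallel>y + real k * b / d\<parallel> < e}"
  assume "\<not> ?thesis"
  then have "{..<d} = A \<union> B" by (auto simp: A_def B_def not_le)
  then have "d \<le> card A + card B" using card_Un_le[of A B] by (metis card_lessThan)
  moreover have "card A \<le> m"
    using many_near_imp_centre_near[of a d m x e] assms by (force simp: A_def)
  moreover have "card B \<le> l"
    using many_near_imp_centre_near[of b d l y e] assms by (force simp: B_def)
  ultimately show False using assms(3) by simp
qed

lemma ex_far_rotation_pair_count:
  fixes a b d n :: nat and x y :: real
  assumes "coprime a d" "coprime b d" "0 < d" "2 * d \<le> (n + 1) * ((d - 1) div 2)"
  shows "\<exists>k<d. 1 / (real n + 1) \<le> \<parallel>x + real k * a / d\<parallel> \<and> 1 / (real n + 1) \<le> \<parallel>y + real k * b / d\<parallel>"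
proof -
  \<comment> \<open>With half of the rotations allotted to each runner, the numerical hypothesis
    makes both thresholds nonpositive, whatever \<open>x\<close> and \<open>y\<close> are.\<close>
  define m where "m = (d - 1) div 2"
  have m: "m + m < d" using assms(3) by (simp add: m_def)
  have "real (2 * d) \<le> real ((n + 1) * m)"
    using assms(4) unfolding m_def of_nat_le_iff .
  then have "1 / (real n + 1) * d - m / 2 \<le> 0" by (simp add: field_simps)
  then have "1 / (real n + 1) * d - m / 2 \<le> \<parallel>z\<parallel>" for z
    using dist_nearest_int_nonneg[of z] by linarith
  then show ?thesis
    by (intro ex_far_rotation_pair[OF assms(1,2) m])
qed

section \<open>Two and three velocities\<close>

lemma two_velocities:
  fixes p q :: nat and s1 s2 :: real
  assumes "coprime p q" "2 \<le> p" "0 < q"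
  shows "\<exists>t::real. 1 / 3 \<le> \<parallel>p * t + s1\<parallel> \<and> 1 / 3 \<le> \<parallel>q * t + s2\<parallel>"
proof -
  \<comment> \<open>With \<open>u = p * t\<close> the first runner is good on a window of length
    1/3, along which \<open>q * u\<close> sweeps at least \<open>1/3 = 2 * 1/6\<close>. The margin
    1/6 bounds the rotation threshold \<open>p / 3 - (p - 1) / 2\<close> for
    \<open>p >= 2\<close>.\<close>
  obtain u :: real where u: "1/3 - s1 \<le> u" "u \<le> 2/3 - s1" "1/6 \<le> \<parallel>q * u + (p * s2 + (real p - 1) / 2)\<parallel>"
    using ex_far_in_interval[of q "1/6" "2/3 - s1" "1/3 - s1"] assms(3) by force
  define x where "x = q * u / p + s2"
  have px: "p * x + (real p - 1) / 2 = q * u + (p * s2 + (real p - 1) / 2)"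
    using assms(2) by (simp add: x_def field_simps)
  have "1 / 3 * real p - (real p - 1) / 2 \<le> 1/6" using assms(2) by (simp add: field_simps)
  also note u(3)[folded px]
  finally obtain k where k: "k < p" "1/3 \<le> \<parallel>x + real k * q / p\<parallel>"
    using ex_far_rotation[of q p "1/3" x] assms by (auto simp: coprime_commute)
  have "\<parallel>p * ((u + k) / p) + s1\<parallel> = \<parallel>u + s1\<parallel>"
    using assms(2) by (intro dist_nearest_int_eqI[of _ _ "int k"]) simp
  also have "1/3 \<le> \<parallel>u + s1\<parallel>" using u by (intro dist_nearest_int_ge_between[of 0]) auto
  finally have "1/3 \<le> \<parallel>p * ((u + k) / p) + s1\<parallel>" .
  moreover have "q * ((u + k) / p) + s2 = x + real k * q / p"
    by (simp add: x_def field_simps add_divide_distrib)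
  ultimately show ?thesis using k(2) by metis
qed

section \<open>Three pairwise coprime velocities\<close>

text \<open>Steps of length at most 1/2 cannot jump from one open arc of radius 1/4 into the next,
  so an orbit of near points stays around one integer \<open>c\<close> and moves less than 1/2 in
  total.\<close>

lemma ex_far_in_orbit:
  fixes y \<theta> :: real
  assumes "\<bar>\<theta>\<bar> \<le> 1/2" "1/2 \<le> real r * \<bar>\<theta>\<bar>"
  shows "\<exists>i\<le>r. 1/4 \<le> \<parallel>y + real i * \<theta>\<parallel>"
proof (rule ccontr)
  assume "\<not> ?thesis"
  then have near: "\<parallel>y + real i * \<theta>\<parallel> < 1/4" if "i \<le> r" for i using that by (meson not_le)
  obtain c :: int where c: "\<bar>y - of_int c\<bar> < 1/4"
    using near[of 0, unfolded dist_nearest_int_less_iff] by auto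
  have "\<bar>y + real i * \<theta> - of_int c\<bar> < 1/4" if "i \<le> r" for i
    using that
  proof (induction i)
    case (Suc i)
    have IH: "\<bar>y + real i * \<theta> - of_int c\<bar> < 1/4" using Suc by simp
    obtain c' :: int where c': "\<bar>y + real (Suc i) * \<theta> - of_int c'\<bar> < 1/4"
      using near[OF Suc.prems, unfolded dist_nearest_int_less_iff] by auto
    have "real (Suc i) * \<theta> = real i * \<theta> + \<theta>" by (simp add: algebra_simps)
    then have "\<bar>real_of_int c - of_int c'\<bar> < 1" using IH c' assms(1) by linarith
    then have "c = c'" by linarith
    then show ?case using c' by simp
  qed (use c in simp)
  from this[of r] have "\<bar>real r * \<theta>\<bar> < 1/2" using c by linarith
  then show False using assms(2) by (simp add: abs_mult)
qed

text \<open>\<open>e\<close> is the residue of \<open>b / a\<close> modulo \<open>p\<close> of least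
  absolute value: a rotation moving runner \<open>a\<close> by \<open>1 / p\<close> moves runner
  \<open>b\<close> by \<open>e / p\<close>.\<close>

lemma ex_small_multiplier:
  fixes a b p :: nat
  assumes "coprime a p" "coprime b p" "2 \<le> p"
  shows "\<exists>e::int. int p dvd int b - e * int a \<and> e \<noteq> 0 \<and> 2 * \<bar>e\<bar> \<le> int p"
proof -
  obtain u v where uv: "u * int a + v * int p = 1"
    using bezout_int[of "int a" "int p"] assms(1) by (auto simp: coprime_iff_gcd_eq_1)
  define h where "h = int p div 2"
  \<comment> \<open>\<open>u\<close> inverts \<open>a\<close> modulo \<open>p\<close>; shifting by
    \<open>h\<close> before and after the reduction centres the residue at 0.\<close>
  define e where "e = (int b * u + h) mod int p - h"
  have "int p dvd (int b * u + h) - (int b * u + h) mod int p" by (simp add: minus_mod_eq_mult_div)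
  then obtain q where q: "(int b * u + h) mod int p = (int b * u + h) - int p * q" by (metis dvdE diff_diff_eq2 add_diff_cancel_left')
  have "int b - e * int a = int b * (u * int a + v * int p) - e * int a" unfolding uv by simp
  also have "\<dots> = int p * (int b * v + q * int a)" unfolding e_def q by (simp add: algebra_simps)
  finally have dvd: "int p dvd int b - e * int a" by simp
  have "e \<noteq> 0"
  proof
    assume "e = 0"
    then have "p dvd b" using dvd by simp
    then show False using assms(2,3) by (metis coprime_absorb_right coprime_commute is_unit_gcd nat_dvd_1_iff_1 not_numeral_le_zero numeral_le_one_iff semiring_norm(69))
  qed
  have "0 \<le> (int b * u + h) mod int p" "(int b * u + h) mod int p < int p"
    using assms(3) by simp_all
  moreover have "2 * h \<le> int p" "int p \<le> 2 * h + 1" unfolding h_def by linarith+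
  moreover have "2 * \<bar>X - h\<bar> \<le> P"
    if "0 \<le> X" "X < P" "2 * h \<le> P" "P \<le> 2 * h + 1" for X h P :: int
    using that by (auto simp: abs_if)
  ultimately have "2 * \<bar>e\<bar> \<le> int p" unfolding e_def by blast
  then show ?thesis using dvd \<open>e \<noteq> 0\<close> by blast
qed

text \<open>The run \<open>j, \<dots>, j + r\<close> consists of rotations that keep the second runner away from
  the integers; along it the third runner moves in steps of length at most \<open>1/2\<close> over a total
  distance of at least \<open>1/2\<close>, so it cannot stay in the forbidden open arc of length \<open>1/2\<close>.\<close>

lemma three_velocities_from_run:
  fixes a b p r :: nat and e j :: int and u s1 s2 s3 :: real
  assumes p: "0 < p" and ap: "coprime a p"
    and e: "int p dvd int b - e * int a" "2 * \<bar>e\<bar> \<le> int p" "int p \<le> 2 * int r * \<bar>e\<bar>"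
    and u: "1/4 \<le> \<parallel>u + s1\<parallel>"
    and j: "p / 4 \<le> a * u + p * s2 + of_int j" "a * u + p * s2 + of_int j + r \<le> 3 * p / 4"
  shows "\<exists>t::real. 1/4 \<le> \<parallel>p * t + s1\<parallel> \<and> 1/4 \<le> \<parallel>a * t + s2\<parallel> \<and> 1/4 \<le> \<parallel>b * t + s3\<parallel>"
proof -
  obtain w v where wv: "w * int a + v * int p = 1"
    using bezout_int[of "int a" "int p"] ap by (auto simp: coprime_iff_gcd_eq_1)
  from e(1) obtain f where f: "int b = e * int a + int p * f" by (metis dvdE diff_add_cancel add.commute)
  have wa: "1 - real_of_int v * real p = real_of_int w * real a"
    using arg_cong[OF wv, of real_of_int] by simp
  have rb: "real b = of_int e * a + p * of_int f"
    using arg_cong[OF f, of real_of_int] by simp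
  have "2 * \<bar>real_of_int e\<bar> \<le> p" using e(2) by linarith
  then have th1: "\<bar>real_of_int e / p\<bar> \<le> 1/2" using p by (simp add: field_simps)
  have "real_of_int (int p) \<le> of_int (2 * int r * \<bar>e\<bar>)" using e(3) of_int_le_iff by blast
  then have th2: "1/2 \<le> real r * \<bar>real_of_int e / p\<bar>" using p by (simp add: field_simps)
  obtain i where i: "i \<le> r" "1/4 \<le> \<parallel>(b * u / p + s3 + of_int e * of_int j / p) + real i * (of_int e / p)\<parallel>"
    using ex_far_in_orbit[OF th1 th2] by blast
  \<comment> \<open>As \<open>w\<close> inverts \<open>a\<close> modulo \<open>p\<close>, this
    rotation moves runner \<open>a\<close> by \<open>(j + i) / p\<close> up to an integer.\<close>
  define k where "k = w * (j + int i)"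
  define t where "t = (u + of_int k) / p"
  have "\<parallel>p * t + s1\<parallel> = \<parallel>u + s1\<parallel>"
    using p by (intro dist_nearest_int_eqI[of _ _ k]) (simp add: t_def)
  moreover have "1/4 \<le> \<parallel>a * t + s2\<parallel>"
  proof -
    have ak: "a * of_int k = (1 - real_of_int v * real p) * (of_int j + real i)"
      unfolding wa by (simp add: k_def)
    have "a * t + s2 = (a * u + a * of_int k) / p + s2" by (simp add: t_def ring_distribs)
    also have "\<dots> = (a * u + p * s2 + of_int j + i) / p + of_int (- v * (j + int i))"
      unfolding ak using p by (simp add: field_simps)
    finally have "a * t + s2 = (a * u + p * s2 + of_int j + i) / p + of_int (- v * (j + int i))" .
    then have "\<parallel>a * t + s2\<parallel> = \<parallel>(a * u + p * s2 + of_int j + i) / p\<parallel>"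
      by (rule dist_nearest_int_eqI)
    also have "1/4 \<le> \<dots>"
    proof (rule dist_nearest_int_ge_between[of 0])
      have "real i \<le> real r" using i(1) by simp
      then show "of_int 0 + 1/4 \<le> (a * u + p * s2 + of_int j + i) / p"
        "(a * u + p * s2 + of_int j + i) / p \<le> of_int 0 + 1 - 1/4"
        using p j by (simp_all add: field_simps)
    qed
    finally show ?thesis .
  qed
  moreover have "1/4 \<le> \<parallel>b * t + s3\<parallel>"
  proof -
    have ek: "real_of_int e * real a * real_of_int k = of_int e * (1 - real_of_int v * real p) * (of_int j + real i)"
      unfolding wa by (simp add: k_def)
    have "b * t = b * u / p + (real_of_int e * real a * real_of_int k + real p * real_of_int f * real_of_int k) / real p"
      by (simp add: t_def rb add_divide_distrib ring_distribs)
    also have "\<dots> = b * u / p + of_int e * of_int j / p + real i * (of_int e / p)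
      + of_int (f * k - e * v * (j + int i))"
      unfolding ek using p by (simp add: field_simps)
    finally have "\<parallel>b * t + s3\<parallel> = \<parallel>(b * u / p + s3 + of_int e * of_int j / p) + real i * (of_int e / p)\<parallel>"
      by (intro dist_nearest_int_eqI[of _ _ "f * k - e * v * (j + int i)"]) simp
    then show ?thesis using i(2) by simp
  qed
  ultimately show ?thesis using u by metis
qed

lemma three_velocities_even:
  fixes a b p :: nat and s1 s2 s3 :: real
  assumes "even p" "0 < p" "coprime a p" "coprime b p" "2 \<le> a"
  shows "\<exists>t::real. 1/4 \<le> \<parallel>p * t + s1\<parallel> \<and> 1/4 \<le> \<parallel>a * t + s2\<parallel> \<and> 1/4 \<le> \<parallel>b * t + s3\<parallel>"
proof -
  obtain r where r: "p = 2 * r" using assms(1) by blast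
  have p2: "2 \<le> p" using r assms(2) by simp
  obtain e :: int where e: "int p dvd int b - e * int a" "e \<noteq> 0" "2 * \<bar>e\<bar> \<le> int p"
    using ex_small_multiplier[OF assms(3,4) p2] by blast
  \<comment> \<open>Scaled by \<open>p\<close>, the good arc of the second runner has length exactly
    \<open>r = p / 2\<close>, so a run of \<open>r + 1\<close> positions fits only if it starts at
    the end \<open>p / 4\<close>. The margin 1/2 forces this alignment; it is reachable since
    \<open>a * u\<close> sweeps \<open>a / 2 >= 1\<close>.\<close>
  obtain u :: real where u: "1/4 - s1 \<le> u" "u \<le> 3/4 - s1" "1/2 \<le> \<parallel>a * u + (p * s2 - p / 4 + 1/2)\<parallel>"
    using ex_far_in_interval[of a "1/2" "3/4 - s1" "1/4 - s1"] assms(5) by force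
  note f = dist_nearest_int_floor_bounds[OF u(3)]
  show ?thesis
  proof (rule three_velocities_from_run[where j = "- \<lfloor>a * u + (p * s2 - p / 4 + 1/2)\<rfloor>" and r = r and u = u])
    show "int p \<le> 2 * int r * \<bar>e\<bar>" using mult_left_mono[of 1 "\<bar>e\<bar>" "int p"] e(2) r by simp
    show "1/4 \<le> \<parallel>u + s1\<parallel>" using u by (intro dist_nearest_int_ge_between[of 0]) auto
  qed (use assms e f r in simp_all)
qed

lemma three_velocities_odd:
  fixes a b p :: nat and s1 s2 s3 :: real
  assumes "odd p" "odd a" "odd b" "a < p" "b < p" "a \<noteq> b" "coprime a p" "coprime b p"
  shows "\<exists>t::real. 1/4 \<le> \<parallel>p * t + s1\<parallel> \<and> 1/4 \<le> \<parallel>a * t + s2\<parallel> \<and> 1/4 \<le> \<parallel>b * t + s3\<parallel>"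
proof -
  have "0 < a" "0 < b" using assms by (auto simp: odd_pos)
  then have p2: "2 \<le> p" using assms by linarith
  obtain r where r: "p = 2 * r + 1" using assms(1) oddE by blast
  obtain e :: int where e: "int p dvd int b - e * int a" "e \<noteq> 0" "2 * \<bar>e\<bar> \<le> int p"
    using ex_small_multiplier[OF assms(7,8) p2] by blast
  \<comment> \<open>For odd \<open>p\<close> the run has length \<open>r = (p - 1) / 2\<close>, so
    \<open>2 * r * \<bar>e\<bar> >= p\<close> requires \<open>\<bar>e\<bar> >= 2\<close>. Here
    \<open>e = 1\<close> would give \<open>a = b\<close>, and \<open>e = - 1\<close> would give
    \<open>a + b = p\<close>, against parity.\<close>
  have "e \<noteq> 1"
  proof
    assume "e = 1"
    then have "int p dvd int b - int a" using e(1) by simp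
    then have "int p \<le> \<bar>int b - int a\<bar>" using assms(6) dvd_imp_le_int[of "int b - int a" "int p"] by simp
    then show False using assms(4,5) by linarith
  qed
  moreover have "e \<noteq> - 1"
  proof
    assume "e = - 1"
    then have "int p dvd int (b + a)" using e(1) by simp
    then have "p dvd b + a" by (simp only: int_dvd_int_iff)
    then obtain c where c: "b + a = p * c" by blast
    have "p * c < p * 2" using c assms(4,5) by linarith
    moreover have "0 < p * c" using c \<open>0 < a\<close> by linarith
    ultimately have "c = 1" by (auto simp: less_2_cases_iff)
    then show False using c assms(1-3) by (metis even_add mult.right_neutral)
  qed
  ultimately have e2: "2 \<le> \<bar>e\<bar>" using e(2) by linarith
  \<comment> \<open>The run may start anywhere in \<open>[p / 4, p / 4 + 1/2]\<close>, so the margin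
    1/4 about the midpoint of a unit interval suffices, and a sweep of \<open>a / 2 >= 1/2\<close>
    reaches it.\<close>
  obtain u :: real where u: "1/4 - s1 \<le> u" "u \<le> 3/4 - s1" "1/4 \<le> \<parallel>a * u + (p * s2 - p / 4 + 1/4)\<parallel>"
    using ex_far_in_interval[of a "1/4" "3/4 - s1" "1/4 - s1"] \<open>0 < a\<close> by force
  note f = dist_nearest_int_floor_bounds[OF u(3)]
  show ?thesis
  proof (rule three_velocities_from_run[where j = "- \<lfloor>a * u + (p * s2 - p / 4 + 1/4)\<rfloor>" and r = r and u = u])
    have "int p \<le> 2 * int r * 2" using r p2 by linarith
    also have "\<dots> \<le> 2 * int r * \<bar>e\<bar>" using e2 by (intro mult_left_mono) auto
    finally show "int p \<le> 2 * int r * \<bar>e\<bar>" .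
    show "1/4 \<le> \<parallel>u + s1\<parallel>" using u by (intro dist_nearest_int_ge_between[of 0]) auto
    show "p / 4 \<le> a * u + p * s2 + of_int (- \<lfloor>a * u + (p * s2 - p / 4 + 1/4)\<rfloor>)" using f by simp
    have "real p = 2 * r + 1" using r by simp
    then show "a * u + p * s2 + of_int (- \<lfloor>a * u + (p * s2 - p / 4 + 1/4)\<rfloor>) + r \<le> 3 * p / 4" using f by linarith
  qed (use assms e p2 in simp_all)
qed

lemma three_velocities:
  fixes x y z :: nat and s1 s2 s3 :: real
  assumes pos: "0 < x" "0 < y" "0 < z" and ne: "x \<noteq> y" "x \<noteq> z" "y \<noteq> z"
    and cop: "coprime x y" "coprime x z" "coprime y z"
  shows "\<exists>t::real. 1/4 \<le> \<parallel>x * t + s1\<parallel> \<and> 1/4 \<le> \<parallel>y * t + s2\<parallel> \<and> 1/4 \<le> \<parallel>z * t + s3\<parallel>"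
proof -
  have even: "\<exists>t::real. 1/4 \<le> \<parallel>p * t + s1\<parallel> \<and> 1/4 \<le> \<parallel>a * t + s2\<parallel> \<and> 1/4 \<le> \<parallel>b * t + s3\<parallel>"
    if "even p" "0 < p" "coprime p a" "coprime p b" "a \<noteq> b" "0 < a" "0 < b" for p a b :: nat and s1 s2 s3 :: real
  \<comment> \<open>Distinct positive velocities are not both 1, so one of the two can be the runner
    needing velocity at least 2.\<close>
  proof (cases "2 \<le> a")
    case True
    then show ?thesis using three_velocities_even[of p a b] that by (simp add: coprime_commute)
  next
    case False
    then have "2 \<le> b" using that by linarith
    then show ?thesis using three_velocities_even[of p b a s1 s3 s2] that
      by (auto simp: coprime_commute)
  qed
  have odd: "\<exists>t::real. 1/4 \<le> \<parallel>p * t + s1\<parallel> \<and> 1/4 \<le> \<parallel>a * t + s2\<parallel> \<and> 1/4 \<le> \<parallel>b * t + s3\<parallel>"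
    if "odd p" "odd a" "odd b" "coprime p a" "coprime p b" "a \<noteq> b" "a < p" "b < p" for p a b :: nat and s1 s2 s3 :: real
    using three_velocities_odd[of p a b] that by (simp add: coprime_commute)
  consider "even x" | "even y" | "even z"
    | "odd x" "odd y" "odd z" "y < x" "z < x"
    | "odd x" "odd y" "odd z" "x < y" "z < y"
    | "odd x" "odd y" "odd z" "x < z" "y < z"
    using ne by linarith
  then show ?thesis
  proof cases
    case 1 then show ?thesis using even[of x y z] assms by blast
  next
    case 2 then show ?thesis using even[of y x z s2 s1 s3] assms by (auto simp: coprime_commute)
  next
    case 3 then show ?thesis using even[of z x y s3 s1 s2] assms by (auto simp: coprime_commute)
  next
    case 4 then show ?thesis using odd[of x y z] assms by blast
  next
    case 5 then show ?thesis using odd[of y x z s2 s1 s3] assms by (auto simp: coprime_commute)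
  next
    case 6 then show ?thesis using odd[of z x y s3 s1 s2] assms by (auto simp: coprime_commute)
  qed
qed

section \<open>Four velocities\<close>

lemma sLRC_three:
  fixes w1 w2 w3 s1 s2 s3 :: real
  assumes "sLRC 3" "0 < w1" "0 < w2" "0 < w3" "w1 \<noteq> w2" "w1 \<noteq> w3" "w2 \<noteq> w3"
  shows "\<exists>t::real. 1/4 \<le> \<parallel>w1 * t + s1\<parallel> \<and> 1/4 \<le> \<parallel>w2 * t + s2\<parallel> \<and> 1/4 \<le> \<parallel>w3 * t + s3\<parallel>"
proof -
  define w where "w i = (if i = 1 then w1 else if i = 2 then w2 else w3)" for i :: nat
  define s where "s i = (if i = 1 then s1 else if i = 2 then s2 else s3)" for i :: nat
  have I: "{1..3::nat} = {1, 2, 3}" by auto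
  have "inj_on w {1..3}" "\<forall>i\<in>{1..3}. 0 < w i"
    using assms unfolding I by (auto simp: w_def)
  then have "\<exists>t. \<forall>i\<in>{1..3}. 1 / (real 3 + 1) \<le> \<parallel>w i * t + s i\<parallel>"
    using assms(1) unfolding sLRC_def sLRC_holds_for_def by blast
  then obtain t where t: "\<forall>i\<in>{1..3}. 1 / (real 3 + 1) \<le> \<parallel>w i * t + s i\<parallel>" by blast
  show ?thesis
    using t unfolding I by (intro exI[of _ t]) (simp add: w_def s_def)
qed

section \<open>Four velocities, two of them with greatest common divisor 3\<close>

text \<open>If \<open>x\<close> and \<open>x + 1/3\<close> are both in the arc around
  \<open>m\<close>, then \<open>x + 1/6\<close> is within 1/30 of \<open>m\<close>. Tripling gives
  1/10; comparing with \<open>y + 2/3\<close> gives \<open>1/5 + 1/30 = 7/30\<close>.\<close>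

lemma two_thirds_near:
  assumes "\<parallel>x\<parallel> < 1/5" "\<parallel>x + 1/3\<parallel> < 1/5" "\<parallel>y + 2/3\<parallel> < 1/5"
  shows "\<parallel>y - x + 1/2\<parallel> < 7/30" "\<parallel>3 * x + 1/2\<parallel> < 1/10"
proof -
  obtain m :: int where m: "\<bar>x - of_int m\<bar> < 1/5"
    using assms(1)[unfolded dist_nearest_int_less_iff] by auto
  obtain l :: int where l: "\<bar>x + 1/3 - of_int l\<bar> < 1/5"
    using assms(2)[unfolded dist_nearest_int_less_iff] by auto
  obtain k :: int where k: "\<bar>y + 2/3 - of_int k\<bar> < 1/5"
    using assms(3)[unfolded dist_nearest_int_less_iff] by auto
  have "\<bar>real_of_int m - of_int l\<bar> < 1" using m l by linarith
  then have ml: "m = l" by linarith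
  have "\<bar>y - x + 1/2 - of_int (k - m)\<bar> < 7/30" using m l k unfolding ml by (simp add: abs_if split: if_splits)
  then show "\<parallel>y - x + 1/2\<parallel> < 7/30" by (rule le_less_trans[OF dist_nearest_int_le])
  have "\<bar>3 * x + 1/2 - of_int (3 * m)\<bar> < 1/10" using m l unfolding ml by (simp add: abs_if split: if_splits)
  then show "\<parallel>3 * x + 1/2\<parallel> < 1/10" by (rule le_less_trans[OF dist_nearest_int_le])
qed

text \<open>Two arcs of length \<open>2/5\<close> can cover three equally spaced points only if one of them contains two
  of the points and the other the third one, which nearly forces their centres to be antipodal.\<close>

lemma ex_far_third:
  assumes "7/30 \<le> \<parallel>y - x + 1/2\<parallel> \<or> (1/10 \<le> \<parallel>3 * x + 1/2\<parallel> \<and> 1/10 \<le> \<parallel>3 * y + 1/2\<parallel>)"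
  shows "\<exists>k::nat. 1/5 \<le> \<parallel>x + k / 3\<parallel> \<and> 1/5 \<le> \<parallel>y + k / 3\<parallel>"
proof (rule ccontr)
  assume no: "\<not> ?thesis"
  have cover: "\<parallel>x\<parallel> < 1/5 \<or> \<parallel>y\<parallel> < 1/5" "\<parallel>x + 1/3\<parallel> < 1/5 \<or> \<parallel>y + 1/3\<parallel> < 1/5"
    "\<parallel>x + 2/3\<parallel> < 1/5 \<or> \<parallel>y + 2/3\<parallel> < 1/5"
    using spec[OF no[unfolded not_ex], of 0] spec[OF no[unfolded not_ex], of 1]
      spec[OF no[unfolded not_ex], of 2] by (auto simp: not_le)
  have xy: "\<parallel>x - y + 1/2\<parallel> = \<parallel>y - x + 1/2\<parallel>"
    using dist_nearest_int_minus[of "y - x + 1/2"]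
      dist_nearest_int_eqI[of "x - y + 1/2" "- (y - x + 1/2)" 1] by simp
  \<comment> \<open>\<open>p\<close> takes two of the three points and \<open>q\<close> the
    remaining one; the disjuncts differ by shifts of 1/3.\<close>
  have bad: "\<not> (1/10 \<le> \<parallel>3 * p + 1/2\<parallel>) \<and> \<not> (7/30 \<le> \<parallel>q - p + 1/2\<parallel>)"
    if "\<parallel>p\<parallel> < 1/5 \<and> \<parallel>p + 1/3\<parallel> < 1/5 \<and> \<parallel>q + 2/3\<parallel> < 1/5 \<or>
      \<parallel>p + 1/3\<parallel> < 1/5 \<and> \<parallel>p + 2/3\<parallel> < 1/5 \<and> \<parallel>q\<parallel> < 1/5 \<or>
      \<parallel>p\<parallel> < 1/5 \<and> \<parallel>p + 2/3\<parallel> < 1/5 \<and> \<parallel>q + 1/3\<parallel> < 1/5" for p q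
    using that
  proof (elim disjE conjE)
    assume "\<parallel>p\<parallel> < 1/5" "\<parallel>p + 1/3\<parallel> < 1/5" "\<parallel>q + 2/3\<parallel> < 1/5"
    from two_thirds_near[OF this] show ?thesis by simp
  next
    assume *: "\<parallel>p + 1/3\<parallel> < 1/5" "\<parallel>p + 2/3\<parallel> < 1/5" "\<parallel>q\<parallel> < 1/5"
    have "\<parallel>p + 1/3 + 1/3\<parallel> < 1/5" using *(2) by (simp add: add.assoc)
    moreover have "\<parallel>q + 1/3 + 2/3\<parallel> < 1/5" using *(3) dist_nearest_int_add_int[of q 1] by (simp add: add.assoc)
    moreover have "\<parallel>3 * (p + 1/3) + 1/2\<parallel> = \<parallel>3 * p + 1/2\<parallel>"
      by (rule dist_nearest_int_eqI[of _ _ 1]) simp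
    ultimately show ?thesis using two_thirds_near[of "p + 1/3" "q + 1/3"] *(1) by (simp add: not_le)
  next
    assume *: "\<parallel>p\<parallel> < 1/5" "\<parallel>p + 2/3\<parallel> < 1/5" "\<parallel>q + 1/3\<parallel> < 1/5"
    have "\<parallel>p + 2/3 + 1/3\<parallel> < 1/5" using *(1) dist_nearest_int_add_int[of p 1] by (simp add: add.assoc)
    moreover have "\<parallel>q + 2/3 + 2/3\<parallel> = \<parallel>q + 1/3\<parallel>"
      by (rule dist_nearest_int_eqI[of _ _ 1]) simp
    moreover have "\<parallel>3 * (p + 2/3) + 1/2\<parallel> = \<parallel>3 * p + 1/2\<parallel>"
      by (rule dist_nearest_int_eqI[of _ _ 2]) simp
    ultimately show ?thesis using two_thirds_near[of "p + 2/3" "q + 2/3"] *(2,3) by (simp add: not_le)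
  qed
  \<comment> \<open>Taking \<open>q = p\<close> in \<open>bad\<close> excludes that a single arc
    takes all three points.\<close>
  have half: "7/30 \<le> \<parallel>p - p + 1/2\<parallel>" for p
    by (intro dist_nearest_int_ge_between[of 0]) auto
  show False
    using cover bad[of x y] bad[of y x] bad[of x x] bad[of y y] half[of x] half[of y] assms
    unfolding xy by argo
qed

text \<open>Here \<open>u = 3 t\<close>. Since \<open>A\<close> and \<open>B\<close> may be negative, the two exceptional velocities can be
  normalised to be congruent to \<open>1\<close> modulo \<open>3\<close>.\<close>

lemma four_velocities_from_scaled_time:
  fixes c d :: nat and A B :: int and u s1 s2 s3 s4 :: real
  assumes mod3: "3 dvd A - 1" "3 dvd B - 1"
    and u: "1/5 \<le> \<parallel>c * u + s1\<parallel>" "1/5 \<le> \<parallel>d * u + s2\<parallel>"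
    and far: "7/30 \<le> \<parallel>(of_int B - of_int A) / 3 * u + (s4 - s3 + 1/2)\<parallel> \<or>
      (1/10 \<le> \<parallel>of_int A * u + (3 * s3 + 1/2)\<parallel> \<and> 1/10 \<le> \<parallel>of_int B * u + (3 * s4 + 1/2)\<parallel>)"
  shows "\<exists>t::real. 1/5 \<le> \<parallel>3 * real c * t + s1\<parallel> \<and> 1/5 \<le> \<parallel>3 * real d * t + s2\<parallel> \<and>
    1/5 \<le> \<parallel>of_int A * t + s3\<parallel> \<and> 1/5 \<le> \<parallel>of_int B * t + s4\<parallel>"
proof -
  define x where "x = of_int A * u / 3 + s3"
  define y where "y = of_int B * u / 3 + s4"
  have eqs: "(of_int B - of_int A) / 3 * u + (s4 - s3 + 1/2) = y - x + 1/2"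
    "of_int A * u + (3 * s3 + 1/2) = 3 * x + 1/2" "of_int B * u + (3 * s4 + 1/2) = 3 * y + 1/2"
    by (simp_all add: x_def y_def field_simps)
  obtain k :: nat where k: "1/5 \<le> \<parallel>x + k / 3\<parallel>" "1/5 \<le> \<parallel>y + k / 3\<parallel>"
    using ex_far_third far unfolding eqs by blast
  define t where "t = (u + k) / 3"
  \<comment> \<open>For \<open>C\<close> congruent to 1 modulo 3, \<open>C * k / 3\<close> equals
    \<open>k / 3\<close> up to an integer, so both exceptional runners are shifted alike.\<close>
  have shift: "\<parallel>of_int C * t + s\<parallel> = \<parallel>of_int C * u / 3 + s + k / 3\<parallel>" if "3 dvd C - 1" for C :: int and s
  proof -
    from that obtain f where f: "C - 1 = 3 * f" by blast
    have C: "real_of_int C = 1 + 3 * of_int f" using arg_cong[OF f, of real_of_int] by simp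
    show ?thesis
      by (rule dist_nearest_int_eqI[of _ _ "f * int k"]) (simp add: t_def C field_simps)
  qed
  have "\<parallel>3 * real m * t + s\<parallel> = \<parallel>m * u + s\<parallel>" for m :: nat and s
    by (rule dist_nearest_int_eqI[of _ _ "int (m * k)"]) (simp add: t_def field_simps)
  then show ?thesis
    using u k shift[OF mod3(1), of s3] shift[OF mod3(2), of s4]
    by (intro exI[of _ t]) (simp add: x_def y_def)
qed

lemma ex_far_slopes_apart:
  fixes r R :: nat and p \<alpha> \<beta> :: real
  assumes "1 \<le> r" "r + 3 \<le> R"
  shows "\<exists>u\<ge>p. u \<le> p + 3/10 \<and> 1/10 \<le> \<parallel>real r * u + \<alpha>\<parallel> \<and> 1/10 \<le> \<parallel>real R * u + \<beta>\<parallel>"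
proof -
  \<comment> \<open>The slope \<open>r\<close> leaves a good piece of length \<open>h\<close>, which
    must satisfy \<open>R * h >= 1/5\<close>. For \<open>r >= 2\<close> one gets
    \<open>h = 1 / (5 * r)\<close>; for \<open>r = 1\<close> the window is capped at 3/10, so
    \<open>h = 1/20\<close>, and \<open>R >= 4\<close> is just enough.\<close>
  define L where "L = (if r = 1 then 3/10 else 3 / (5 * real r))"
  define h where "h = (L - 2 * (1/10) / r) / 2"
  have L: "2 * (1/10) \<le> r * L" "r * L \<le> 1 - 2 * (1/10)" "L \<le> 3/10"
    using assms(1) by (auto simp: L_def field_simps)
  have hR: "2 * (1/10) \<le> real R * h"
  proof (cases "r = 1")
    case True
    then show ?thesis using assms(2) by (simp add: h_def L_def)
  next
    case False
    then have h: "h = 1 / (5 * real r)" using assms(1) by (simp add: h_def L_def field_simps)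
    from h have "2 * (1/10) = real r * h" using assms(1) by simp
    also have "\<dots> \<le> real R * h" using assms(2) h by (intro mult_right_mono) auto
    finally show ?thesis .
  qed
  obtain lo where lo: "p \<le> lo" "lo + h \<le> p + L"
    "\<And>u. lo \<le> u \<Longrightarrow> u \<le> lo + h \<Longrightarrow> 1/10 \<le> \<parallel>real r * u + \<alpha>\<parallel>"
    using ex_far_subinterval[of "real r" "1/10" L p \<alpha>] assms(1) L unfolding h_def by auto
  have "0 < real R" "2 * (1/10) \<le> real R * (lo + h - lo)" using assms hR by simp_all
  from ex_far_in_interval[OF this, of \<beta>]
  obtain u :: real where "lo \<le> u" "u \<le> lo + h" "1/10 \<le> \<parallel>R * u + \<beta>\<parallel>" by auto
  then show ?thesis using lo L(3) by (intro exI[of _ u]) auto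
qed

text \<open>This pair of slopes, arising from \<open>A = - 2\<close>, is too close for
  \<open>ex_far_slopes_apart\<close>; sampling four equally spaced times settles it.\<close>

lemma ex_far_slopes_one_two:
  fixes p \<alpha> \<beta> :: real
  shows "\<exists>u\<ge>p. u \<le> p + 3/10 \<and> 1/10 \<le> \<parallel>u + \<alpha>\<parallel> \<and> 1/10 \<le> \<parallel>2 * u + \<beta>\<parallel>"
proof (rule ccontr)
  assume no: "\<not> ?thesis"
  have cover: "\<parallel>p + \<alpha> + i\<parallel> < 1/10 \<or> \<parallel>2 * p + \<beta> + 2 * i\<parallel> < 1/10" if "0 \<le> i" "i \<le> 3/10" for i
  proof -
    have "\<not> (1/10 \<le> \<parallel>p + i + \<alpha>\<parallel> \<and> 1/10 \<le> \<parallel>2 * (p + i) + \<beta>\<parallel>)"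
      using no that by (metis add_left_mono add_increasing2 order_refl)
    then show ?thesis by (auto simp: not_le algebra_simps)
  qed
  (* Among the four points p, p + 1/10, p + 2/10, p + 3/10 at most two are bad for the slope 1
     and at most one is bad for the slope 2. *)
  have X: "1/10 \<le> \<parallel>p + \<alpha> + i\<parallel> \<or> 1/10 \<le> \<parallel>p + \<alpha> + j\<parallel>" if "1/5 \<le> j - i" "j - i \<le> 4/5" for i j
    using that by (intro not_both_near_int) auto
  have Y: "1/10 \<le> \<parallel>2 * p + \<beta> + 2 * i\<parallel> \<or> 1/10 \<le> \<parallel>2 * p + \<beta> + 2 * j\<parallel>"
    if "1/10 \<le> j - i" "j - i \<le> 2/5" for i j
    using that by (intro not_both_near_int) auto
  show False
    using cover[of 0] cover[of "1/10"] cover[of "2/10"] cover[of "3/10"]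
      X[where i = 0 and j = "2/10"] X[where i = 0 and j = "3/10"] X[where i = "1/10" and j = "3/10"]
      Y[where i = 0 and j = "1/10"] Y[where i = 0 and j = "2/10"] Y[where i = 0 and j = "3/10"]
      Y[where i = "1/10" and j = "2/10"] Y[where i = "1/10" and j = "3/10"]
      Y[where i = "2/10" and j = "3/10"]
    by argo
qed

lemma ex_far_gap_three:
  fixes A :: int and p \<alpha> \<beta> :: real
  assumes "3 dvd A - 1"
  shows "\<exists>u\<ge>p. u \<le> p + 3/10 \<and> 1/10 \<le> \<parallel>of_int A * u + \<alpha>\<parallel> \<and> 1/10 \<le> \<parallel>(of_int A + 3) * u + \<beta>\<parallel>"
proof -
  \<comment> \<open>The congruence keeps both slopes nonzero and leaves \<open>- 2\<close> as the
    only value between which the slopes differ in sign.\<close>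
  have "A \<noteq> 0" "A \<noteq> - 1" "A \<noteq> - 3" using assms by (auto simp: dvd_def) presburger+
  then consider "1 \<le> A" | "A = - 2" | "A \<le> - 4" by linarith
  then show ?thesis
  proof cases
    case 1
    then have "real (nat A) = of_int A" "real (nat (A + 3)) = of_int A + 3" by simp_all
    moreover have "1 \<le> nat A" "nat A + 3 \<le> nat (A + 3)" using 1 by simp_all
    ultimately show ?thesis using ex_far_slopes_apart[of "nat A" "nat (A + 3)" p \<alpha> \<beta>] by metis
  next
    case 2
    have "\<parallel>of_int A * u + \<alpha>\<parallel> = \<parallel>2 * u + (- \<alpha>)\<parallel>" for u :: real
      using dist_nearest_int_minus[of "2 * u - \<alpha>"] 2 by simp
    then show ?thesis using ex_far_slopes_one_two[of p \<beta> "- \<alpha>"] 2 by auto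
  next
    case 3
    then have "real (nat (- A)) = - of_int A" "real (nat (- A - 3)) = - of_int A - 3" by simp_all
    moreover have "1 \<le> nat (- A - 3)" "nat (- A - 3) + 3 \<le> nat (- A)" using 3 by simp_all
    ultimately obtain u where u: "p \<le> u" "u \<le> p + 3/10"
      "1/10 \<le> \<parallel>(- of_int A - 3) * u + (- \<beta>)\<parallel>" "1/10 \<le> \<parallel>(- of_int A) * u + (- \<alpha>)\<parallel>"
      using ex_far_slopes_apart[of "nat (- A - 3)" "nat (- A)" p "- \<beta>" "- \<alpha>"] by metis
    have "\<parallel>(- of_int A) * u + (- \<alpha>)\<parallel> = \<parallel>of_int A * u + \<alpha>\<parallel>"
      "\<parallel>(- of_int A - 3) * u + (- \<beta>)\<parallel> = \<parallel>(of_int A + 3) * u + \<beta>\<parallel>"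
      using dist_nearest_int_minus[of "of_int A * u + \<alpha>"] dist_nearest_int_minus[of "(of_int A + 3) * u + \<beta>"]
      by (simp_all add: algebra_simps)
    then show ?thesis using u by auto
  qed
qed

text \<open>Two times whose difference lies in \<open>[7/15, 8/15]\<close> are not both within \<open>7/30\<close> of \<open>\<int> - \<gamma>\<close>, so it
  suffices to find such a pair that is good for \<open>1\<close> and \<open>d\<close>. For \<open>d = 2\<close> there may be none, but then
  a whole interval of length \<open>3/10\<close> is good for \<open>1\<close> and \<open>d\<close>.\<close>

lemma ex_far_gap_unit:
  fixes d :: nat and A :: int and s1 s2 \<alpha> \<beta> \<gamma> :: real
  assumes A: "3 dvd A - 1" and d: "2 \<le> d"
  shows "\<exists>u::real. 1/5 \<le> \<parallel>u + s1\<parallel> \<and> 1/5 \<le> \<parallel>real d * u + s2\<parallel> \<and>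
    (7/30 \<le> \<parallel>u + \<gamma>\<parallel> \<or> (1/10 \<le> \<parallel>of_int A * u + \<alpha>\<parallel> \<and> 1/10 \<le> \<parallel>(of_int A + 3) * u + \<beta>\<parallel>))"
proof -
  define lo where "lo = 1/5 - s1"
  have free: "1/5 \<le> \<parallel>u + s1\<parallel>" if "lo \<le> u" "u \<le> lo + 3/5" for u
    using that by (intro dist_nearest_int_ge_between[of 0]) (auto simp: lo_def)
  have pair: ?thesis
    if "lo \<le> u" "u' \<le> lo + 3/5" "7/15 \<le> u' - u" "u' - u \<le> 8/15"
      "1/5 \<le> \<parallel>real d * u + s2\<parallel>" "1/5 \<le> \<parallel>real d * u' + s2\<parallel>" for u u'
  proof -
    have "7/30 \<le> \<parallel>u + \<gamma>\<parallel> \<or> 7/30 \<le> \<parallel>u' + \<gamma>\<parallel>"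
      using that by (intro not_both_near_int) auto
    then show ?thesis using free[of u] free[of u'] that by auto
  qed
  define k where "k = \<lfloor>d * lo + s2 + 1/5\<rfloor>"
  \<comment> \<open>\<open>w\<close> is the phase of the \<open>d\<close>-runner at
    \<open>lo\<close>, in the period beginning at the left end of a bad arc; phase \<open>g\<close>
    is reached at time \<open>lo + (g - w) / d\<close>.\<close>
  define w where "w = d * lo + s2 - of_int k"
  have w: "- (1/5) \<le> w" "w < 4/5"
    unfolding w_def k_def using floor_correct[of "d * lo + s2 + 1/5"] by linarith+
  have dpos: "0 < real d" using d by simp
  have phase: "\<parallel>d * (lo + (g - w) / d) + s2\<parallel> = \<parallel>g\<parallel>" for g
    using dpos by (intro dist_nearest_int_eqI[of _ _ k]) (simp add: w_def field_simps)
  consider "4 \<le> d" | "d = 3" | "d = 2" using d by linarith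
  then show ?thesis
  proof cases
    case 1
    (* Doubling the phase makes the condition invariant under u \<mapsto> u + 1/2 for either parity of d. *)
    have "0 < 2 * real d" "2 * (2/5) \<le> 2 * real d * (lo + 1/10 - lo)" using 1 by simp_all
    from ex_far_in_interval[OF this, of "2 * s2"]
    obtain u where u: "lo \<le> u" "u \<le> lo + 1/10" "2/5 \<le> \<parallel>2 * real d * u + 2 * s2\<parallel>" by auto
    have half: "\<parallel>2 * z\<parallel> \<le> 2 * \<parallel>z\<parallel>" for z using dist_nearest_int_triangle[of z z] by simp
    have "1/5 \<le> \<parallel>d * u + s2\<parallel>" using half[of "d * u + s2"] u(3) by (simp add: algebra_simps)
    moreover have "\<parallel>2 * (d * (u + 1/2) + s2)\<parallel> = \<parallel>2 * real d * u + 2 * s2\<parallel>"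
      by (rule dist_nearest_int_eqI[of _ _ "int d"]) (simp add: algebra_simps)
    then have "1/5 \<le> \<parallel>d * (u + 1/2) + s2\<parallel>" using half[of "d * (u + 1/2) + s2"] u(3) by simp
    ultimately show ?thesis using u by (intro pair[of u "u + 1/2"]) auto
  next
    case 2
    \<comment> \<open>A phase advance of 7/5 takes time 7/15, the least gap that \<open>pair\<close>
      accepts. Ending by \<open>lo + 3/5\<close> means by phase \<open>w + 9/5\<close>, hence
      \<open>g <= w + 2/5\<close>.\<close>
    have three: ?thesis if "w \<le> g" "g \<le> w + 2/5" "1/5 \<le> \<parallel>g\<parallel>" "1/5 \<le> \<parallel>g + 7/5\<parallel>" for g
      by (rule pair[of "lo + (g - w) / d" "lo + (g + 7/5 - w) / d"])
        (use that phase[of g] phase[of "g + 7/5"] 2 in \<open>simp_all add: field_simps\<close>)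
    consider "w \<le> 1/5" | "1/5 \<le> w" "w \<le> 2/5" | "2/5 \<le> w" by linarith
    then show ?thesis
    proof cases
      case 1
      show ?thesis
      proof (rule three[of "1/5"])
        show "1/5 \<le> \<parallel>1/5::real\<parallel>" by (rule dist_nearest_int_ge_between[of 0]) auto
        show "1/5 \<le> \<parallel>1/5 + 7/5::real\<parallel>" by (rule dist_nearest_int_ge_between[of 1]) auto
      qed (use 1 w in auto)
    next
      case 2
      show ?thesis
      proof (rule three[of "2/5"])
        show "1/5 \<le> \<parallel>2/5::real\<parallel>" by (rule dist_nearest_int_ge_between[of 0]) auto
        show "1/5 \<le> \<parallel>2/5 + 7/5::real\<parallel>" by (rule dist_nearest_int_ge_between[of 1]) auto
      qed (use 2 w in auto)
    next
      case 3
      show ?thesis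
      proof (rule three[of "4/5"])
        show "1/5 \<le> \<parallel>4/5::real\<parallel>" by (rule dist_nearest_int_ge_between[of 0]) auto
        show "1/5 \<le> \<parallel>4/5 + 7/5::real\<parallel>" by (rule dist_nearest_int_ge_between[of 2]) auto
      qed (use 3 w in auto)
    qed
  next
    case 3
    show ?thesis
    proof (cases "0 \<le> w")
      case True
      \<comment> \<open>Phases \<open>g\<close> and \<open>g + 1\<close> are 1/2 apart in time, and
        \<open>g <= w + 1/5\<close> fits both into the total advance 6/5.\<close>
      define g where "g = max w (1/5)"
      have g: "1/5 \<le> \<parallel>g\<parallel>" "1/5 \<le> \<parallel>g + 1\<parallel>" "w \<le> g" "g \<le> w + 1/5"
        using w True dist_nearest_int_ge_between[of 0 "1/5" g] dist_nearest_int_ge_between[of 1 "1/5" "g + 1"]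
        by (auto simp: g_def)
      show ?thesis
        by (rule pair[of "lo + (g - w) / d" "lo + (g + 1 - w) / d"])
          (use g phase[of g] phase[of "g + 1"] 3 in \<open>simp_all add: field_simps\<close>)
    next
      case False
      \<comment> \<open>Now the whole good arc of phases from 1/5 to 4/5 lies inside the window;
        \<open>p\<close> is its starting time and it lasts 3/10.\<close>
      define p where "p = lo + (1/5 - w) / d"
      obtain u where u: "p \<le> u" "u \<le> p + 3/10"
        "1/10 \<le> \<parallel>of_int A * u + \<alpha>\<parallel>" "1/10 \<le> \<parallel>(of_int A + 3) * u + \<beta>\<parallel>"
        using ex_far_gap_three[OF A] by blast
      have "2 * p = 2 * lo + 1/5 - w" using 3 by (simp add: p_def)
      then have "lo \<le> u" "u \<le> lo + 3/5" using u(1,2) w False by linarith+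
      moreover have "1/5 \<le> \<parallel>d * u + s2\<parallel>"
      proof (rule dist_nearest_int_ge_between[of k])
        have "w = 2 * lo + s2 - of_int k" using 3 by (simp add: w_def)
        then show "of_int k + 1/5 \<le> d * u + s2" "d * u + s2 \<le> of_int k + 1 - 1/5"
          using u(1,2) \<open>2 * p = 2 * lo + 1/5 - w\<close> 3 by simp_all
      qed
      ultimately show ?thesis using free u by blast
    qed
  qed
qed

text \<open>For \<open>c >= 2\<close> the value \<open>w\<close> of \<open>c * u\<close> is chosen
  first, good for the \<open>c\<close>-runner and for the gap, since its window 3/5 exceeds
  \<open>2 * 7/30\<close>. Rotating \<open>u\<close> by multiples of \<open>1 / c\<close> then keeps
  \<open>w\<close> modulo 1 and frees the \<open>d\<close>-runner.\<close>

lemma ex_far_gap: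
  fixes c d :: nat and A :: int and s1 s2 \<alpha> \<beta> \<gamma> :: real
  assumes A: "3 dvd A - 1" and cd: "coprime c d" "0 < c" "0 < d" "c \<noteq> d"
  shows "\<exists>u::real. 1/5 \<le> \<parallel>real c * u + s1\<parallel> \<and> 1/5 \<le> \<parallel>real d * u + s2\<parallel> \<and>
    (7/30 \<le> \<parallel>real c * u + \<gamma>\<parallel> \<or> (1/10 \<le> \<parallel>of_int A * u + \<alpha>\<parallel> \<and> 1/10 \<le> \<parallel>(of_int A + 3 * real c) * u + \<beta>\<parallel>))"
proof (cases "c = 1")
  case True
  then have "2 \<le> d" using cd by linarith
  then show ?thesis using ex_far_gap_unit[OF A, of d] True by simp
next
  case False
  then have c: "2 \<le> c" using cd by linarith
  obtain w where w: "1/5 - s1 \<le> w" "w \<le> 4/5 - s1" "7/30 \<le> \<parallel>w + \<gamma>\<parallel>"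
    using ex_far_in_interval[of 1 "7/30" "4/5 - s1" "1/5 - s1" \<gamma>] by auto
  have w1: "1/5 \<le> \<parallel>w + s1\<parallel>" using w by (intro dist_nearest_int_ge_between[of 0]) auto
  obtain k where k: "1/5 \<le> \<parallel>(d * (w / c) + s2) + real k * d / c\<parallel>"
    using ex_far_rotation_quarter[of d c "1/5" "d * (w / c) + s2"] cd(1) c by (auto simp: coprime_commute)
  define u where "u = (w + k) / c"
  have "\<parallel>real c * u + s\<parallel> = \<parallel>w + s\<parallel>" for s
    using c by (intro dist_nearest_int_eqI[of _ _ "int k"]) (simp add: u_def)
  moreover have "d * u + s2 = (d * (w / c) + s2) + real k * d / c"
    by (simp add: u_def ring_distribs add_divide_distrib)
  then have "1/5 \<le> \<parallel>d * u + s2\<parallel>" using k by (simp only:)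
  ultimately have "1/5 \<le> \<parallel>c * u + s1\<parallel> \<and> 1/5 \<le> \<parallel>d * u + s2\<parallel> \<and> 7/30 \<le> \<parallel>c * u + \<gamma>\<parallel>"
    using w w1 by simp
  then show ?thesis by blast
qed

text \<open>The difference of the exceptional runners has velocity \<open>(B - A) / 3\<close> in the
  time \<open>u\<close>. If this is \<open>c\<close> or \<open>d\<close> up to sign,
  \<open>ex_far_gap\<close> applies; otherwise the hypothesis gives distance
  \<open>1/4 >= 7/30\<close>.\<close>

lemma four_velocities_thirds_signed:
  fixes c d :: nat and A B :: int and s1 s2 s3 s4 :: real
  assumes sLRC: "sLRC 3" and cd: "coprime c d" "0 < c" "0 < d" "c \<noteq> d"
    and AB: "3 dvd A - 1" "3 dvd B - 1" "A \<noteq> B"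
  shows "\<exists>t::real. 1/5 \<le> \<parallel>3 * real c * t + s1\<parallel> \<and> 1/5 \<le> \<parallel>3 * real d * t + s2\<parallel> \<and>
    1/5 \<le> \<parallel>of_int A * t + s3\<parallel> \<and> 1/5 \<le> \<parallel>of_int B * t + s4\<parallel>"
proof -
  have gap: "\<exists>t::real. 1/5 \<le> \<parallel>3 * real x * t + r1\<parallel> \<and> 1/5 \<le> \<parallel>3 * real y * t + r2\<parallel> \<and>
      1/5 \<le> \<parallel>of_int P * t + r3\<parallel> \<and> 1/5 \<le> \<parallel>of_int Q * t + r4\<parallel>"
    if h: "coprime x y" "0 < x" "0 < y" "x \<noteq> y" "3 dvd P - 1" "3 dvd Q - 1" "Q = P + 3 * int x"
    for x y P Q r1 r2 r3 r4
  proof -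
    obtain u where u: "1/5 \<le> \<parallel>real x * u + r1\<parallel>" "1/5 \<le> \<parallel>real y * u + r2\<parallel>"
      "7/30 \<le> \<parallel>real x * u + (r4 - r3 + 1/2)\<parallel> \<or> (1/10 \<le> \<parallel>of_int P * u + (3 * r3 + 1/2)\<parallel> \<and>
        1/10 \<le> \<parallel>(of_int P + 3 * real x) * u + (3 * r4 + 1/2)\<parallel>)"
      using ex_far_gap[OF h(5,1-4)] by blast
    have "real_of_int Q = of_int P + 3 * real x" "(real_of_int Q - of_int P) / 3 = real x"
      using h(7) by simp_all
    then show ?thesis
      using u by (intro four_velocities_from_scaled_time[of P Q x u r1 y r2 r4 r3] h) simp_all
  qed
  obtain e where e: "B - A = 3 * e"
    using AB(1,2) dvd_diff[OF AB(2,1)] by (auto simp: dvd_def)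
  have "e \<noteq> 0" using e AB(3) by auto
  consider "e = int c" | "e = - int c" | "e = int d" | "e = - int d"
    | "\<bar>e\<bar> \<noteq> int c" "\<bar>e\<bar> \<noteq> int d" by linarith
  then show ?thesis
  proof cases
    case 1
    then have "B = A + 3 * int c" using e by simp
    then show ?thesis using gap[of c d A B s1 s2 s3 s4] cd AB by blast
  next
    case 2
    then have "A = B + 3 * int c" using e by simp
    then show ?thesis using gap[of c d B A s1 s2 s4 s3] cd AB by blast
  next
    case 3
    then have "B = A + 3 * int d" using e by simp
    then show ?thesis using gap[of d c A B s2 s1 s3 s4] cd AB by (metis coprime_commute)
  next
    case 4
    then have "A = B + 3 * int d" using e by simp
    then show ?thesis using gap[of d c B A s2 s1 s4 s3] cd AB by (metis coprime_commute)
  next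
    case 5
    (* |e| is the velocity of the difference of the exceptional runners in the time u. *)
    define s where "s = (if e > 0 then s4 - s3 + 1/2 else - (s4 - s3 + 1/2))"
    have "real c \<noteq> of_int \<bar>e\<bar>" "real d \<noteq> of_int \<bar>e\<bar>" using 5 by linarith+
    then obtain u where u: "1/4 \<le> \<parallel>real c * u + s1\<parallel>" "1/4 \<le> \<parallel>real d * u + s2\<parallel>"
      "1/4 \<le> \<parallel>of_int \<bar>e\<bar> * u + s\<parallel>"
      using sLRC_three[OF sLRC, of "real c" "real d" "of_int \<bar>e\<bar>" s1 s2 s] cd \<open>e \<noteq> 0\<close> by auto
    have "(real_of_int B - of_int A) / 3 = of_int e"
      using arg_cong[OF e, of real_of_int] by simp
    moreover have "\<parallel>of_int e * u + (s4 - s3 + 1/2)\<parallel> = \<parallel>of_int \<bar>e\<bar> * u + s\<parallel>"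
      using dist_nearest_int_minus[of "of_int e * u + (s4 - s3 + 1/2)"] \<open>e \<noteq> 0\<close>
      by (auto simp: s_def abs_if algebra_simps)
    ultimately have "7/30 \<le> \<parallel>(real_of_int B - of_int A) / 3 * u + (s4 - s3 + 1/2)\<parallel>"
      using u(3) by simp
    then show ?thesis
      using u by (intro four_velocities_from_scaled_time[OF AB(1,2), of c u s1 d]) auto
  qed
qed

lemma four_velocities_thirds:
  fixes a b c d :: nat and s1 s2 s3 s4 :: real
  assumes sLRC: "sLRC 3" and cd: "coprime c d" "0 < c" "0 < d" "c \<noteq> d"
    and ab: "coprime a 3" "coprime b 3" "a \<noteq> b"
  shows "\<exists>t::real. 1/5 \<le> \<parallel>3 * real c * t + s1\<parallel> \<and> 1/5 \<le> \<parallel>3 * real d * t + s2\<parallel> \<and>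
    1/5 \<le> \<parallel>real a * t + s3\<parallel> \<and> 1/5 \<le> \<parallel>real b * t + s4\<parallel>"
proof -
  have sgn: "\<exists>A::int. 3 dvd A - 1 \<and> (A = int x \<or> A = - int x)" if x: "coprime x 3" for x :: nat
  proof -
    have "x mod 3 \<noteq> 0" using x by (metis coprime_absorb_right dvd_eq_mod_eq_0 is_unit_gcd numeral_eq_one_iff nat_dvd_1_iff_1 semiring_norm(86))
    then consider "x mod 3 = 1" | "x mod 3 = 2" by linarith
    then show ?thesis
    proof cases
      case 1
      then have "3 dvd int x - 1" by presburger
      then show ?thesis by blast
    next
      case 2
      then have "3 dvd - int x - 1" by presburger
      then show ?thesis by blast
    qed
  qed
  obtain A where A: "3 dvd A - 1" "A = int a \<or> A = - int a" using sgn[OF ab(1)] by blast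
  obtain B where B: "3 dvd B - 1" "B = int b \<or> B = - int b" using sgn[OF ab(2)] by blast
  have flip: "\<exists>r. \<forall>t::real. \<parallel>of_int C * t + r\<parallel> = \<parallel>real x * t + s\<parallel>" if "C = int x \<or> C = - int x" for C x s
    using that
  proof
    assume "C = - int x"
    then have "\<parallel>of_int C * t + - s\<parallel> = \<parallel>real x * t + s\<parallel>" for t :: real
      using dist_nearest_int_minus[of "real x * t + s"] by simp
    then show ?thesis by blast
  qed auto
  obtain r3 r4 where r: "\<And>t::real. \<parallel>of_int A * t + r3\<parallel> = \<parallel>real a * t + s3\<parallel>"
    "\<And>t::real. \<parallel>of_int B * t + r4\<parallel> = \<parallel>real b * t + s4\<parallel>"
    using flip[OF A(2), of s3] flip[OF B(2), of s4] by blast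
  have "A \<noteq> B" using A B ab(3) by auto
  from four_velocities_thirds_signed[OF sLRC cd A(1) B(1) this, of s1 s2 r3 r4] show ?thesis
    unfolding r .
qed

section \<open>Four velocities, larger common divisors\<close>

lemma four_velocities_count:
  fixes a b c d m :: nat and s1 s2 s3 s4 :: real
  assumes sLRC: "sLRC 3" and cd: "0 < c" "0 < d" "c \<noteq> d"
    and ab: "coprime a m" "coprime b m" and m: "0 < m" "2 * m \<le> 5 * ((m - 1) div 2)"
  shows "\<exists>t::real. 1/5 \<le> \<parallel>real m * real c * t + s1\<parallel> \<and> 1/5 \<le> \<parallel>real m * real d * t + s2\<parallel> \<and>
    1/5 \<le> \<parallel>real a * t + s3\<parallel> \<and> 1/5 \<le> \<parallel>real b * t + s4\<parallel>"
proof -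
  \<comment> \<open>\<open>c + d\<close> completes the triple, being distinct from \<open>c\<close>
    and \<open>d\<close>.\<close>
  obtain u :: real where u: "1/4 \<le> \<parallel>real c * u + s1\<parallel>" "1/4 \<le> \<parallel>real d * u + s2\<parallel>"
    using sLRC_three[OF sLRC, of "real c" "real d" "real (c + d)" s1 s2 0] cd by auto
  obtain k where k: "1/5 \<le> \<parallel>(a * u / m + s3) + real k * a / m\<parallel>" "1/5 \<le> \<parallel>(b * u / m + s4) + real k * b / m\<parallel>"
    using ex_far_rotation_pair_count[OF ab m(1), of 4 "a * u / m + s3" "b * u / m + s4"] m(2) by auto
  define t where "t = (u + k) / m"
  have "\<parallel>real m * real x * t + s\<parallel> = \<parallel>real x * u + s\<parallel>" for x s
    using m(1) by (intro dist_nearest_int_eqI[of _ _ "int (x * k)"]) (simp add: t_def field_simps)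
  moreover have *: "(x * u / m + s) + real k * x / m = real x * t + s" for x s
    by (simp add: t_def ring_distribs add_divide_distrib)
  ultimately show ?thesis using u k[unfolded *] by (intro exI[of _ t]) simp
qed

lemma four_velocities_odd:
  fixes a b c d m :: nat and s1 s2 s3 s4 :: real
  assumes "sLRC 3" "odd m" "3 \<le> m" "coprime c d" "0 < c" "0 < d" "c \<noteq> d"
    and "coprime a m" "coprime b m" "a \<noteq> b"
  shows "\<exists>t::real. 1/5 \<le> \<parallel>real m * real c * t + s1\<parallel> \<and> 1/5 \<le> \<parallel>real m * real d * t + s2\<parallel> \<and>
    1/5 \<le> \<parallel>real a * t + s3\<parallel> \<and> 1/5 \<le> \<parallel>real b * t + s4\<parallel>"
proof (cases "m = 3")
  case True
  then show ?thesis using four_velocities_thirds[of c d a b s1 s2 s3 s4] assms by simp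
next
  case False
  \<comment> \<open>For odd \<open>m\<close> this inequality is equivalent to
    \<open>m >= 5\<close>.\<close>
  then have "2 * m \<le> 5 * ((m - 1) div 2)" using assms(2,3) by presburger
  then show ?thesis using four_velocities_count[of c d a m b s1 s2 s3 s4] assms by simp
qed

text \<open>The \<open>2 * h - 1\<close> bad rotations that can be tolerated are split as
  \<open>h - 1\<close> for \<open>a\<close> and \<open>h\<close> for \<open>b\<close>. The bound for
  \<open>b\<close> is automatic; the one for \<open>a\<close> has threshold
  \<open>1/2 - h / 10\<close>, below 1/4 for \<open>h >= 3\<close>, and is met by giving
  \<open>a\<close> to the hypothesis as third velocity.\<close>

lemma four_velocities_even:
  fixes a b c d h :: nat and s1 s2 s3 s4 :: real
  assumes sLRC: "sLRC 3" and h: "3 \<le> h" and pos: "0 < c" "0 < d" "0 < a"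
    and ne: "c \<noteq> d" "a \<noteq> c" "a \<noteq> d" and ab: "coprime a (2 * h)" "coprime b (2 * h)"
  shows "\<exists>t::real. 1/5 \<le> \<parallel>real (2 * h) * real c * t + s1\<parallel> \<and> 1/5 \<le> \<parallel>real (2 * h) * real d * t + s2\<parallel> \<and>
    1/5 \<le> \<parallel>real a * t + s3\<parallel> \<and> 1/5 \<le> \<parallel>real b * t + s4\<parallel>"
proof -
  define m where "m = 2 * h"
  have m: "0 < real m" "real m = 2 * real h" using h by (simp_all add: m_def)
  have h1: "real (h - 1) = real h - 1" using h by simp
  obtain u :: real where u: "1/4 \<le> \<parallel>real c * u + s1\<parallel>" "1/4 \<le> \<parallel>real d * u + s2\<parallel>"
    "1/4 \<le> \<parallel>real a * u + (m * s3 + real (h - 1) / 2)\<parallel>"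
    using sLRC_three[OF sLRC, of "real c" "real d" "real a" s1 s2 "m * s3 + real (h - 1) / 2"] pos ne by auto
  define x where "x = a * u / m + s3"
  define y where "y = b * u / m + s4"
  obtain k where k: "1/5 \<le> \<parallel>x + real k * a / m\<parallel>" "1/5 \<le> \<parallel>y + real k * b / m\<parallel>"
  proof -
    have eq: "real m * x + real (h - 1) / 2 = real a * u + (m * s3 + real (h - 1) / 2)"
      using m(1) by (simp add: x_def field_simps)
    have "1/5 * real m - real (h - 1) / 2 \<le> 1/4" using h unfolding m(2) h1 by (simp add: field_simps)
    then have X: "1/5 * real m - real (h - 1) / 2 \<le> \<parallel>real m * x + real (h - 1) / 2\<parallel>"
      unfolding eq using u(3) by (rule order_trans)
    have "1/5 * real m - real h / 2 \<le> 0" unfolding m(2) by simp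
    then have Y: "1/5 * real m - real h / 2 \<le> \<parallel>real m * y + real h / 2\<parallel>"
      using dist_nearest_int_nonneg order_trans by metis
    have "h - 1 + h < m" using h by (simp add: m_def)
    from ex_far_rotation_pair[OF ab[folded m_def] this X Y] show ?thesis using that by blast
  qed
  define t where "t = (u + k) / m"
  have "\<parallel>real m * real z * t + s\<parallel> = \<parallel>real z * u + s\<parallel>" for z s
    using m(1) by (intro dist_nearest_int_eqI[of _ _ "int (z * k)"]) (simp add: t_def field_simps)
  moreover have *: "(z * u / m + s) + real k * z / m = real z * t + s" for z s
    by (simp add: t_def ring_distribs add_divide_distrib)
  ultimately show ?thesis
    using u k[unfolded x_def y_def *] unfolding m_def[symmetric] by (intro exI[of _ t]) simp
qed

lemma four_velocities:
  fixes a b c d m :: nat and s1 s2 s3 s4 :: real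
  assumes sLRC: "sLRC 3" and m: "3 \<le> m" "m \<noteq> 4" and cd: "coprime c d" "0 < c" "0 < d" "c \<noteq> d"
    and ab: "coprime a m" "coprime b m" "0 < a" "0 < b" "a \<noteq> b"
  shows "\<exists>t::real. 1/5 \<le> \<parallel>real m * real c * t + s1\<parallel> \<and> 1/5 \<le> \<parallel>real m * real d * t + s2\<parallel> \<and>
    1/5 \<le> \<parallel>real a * t + s3\<parallel> \<and> 1/5 \<le> \<parallel>real b * t + s4\<parallel>"
proof (cases "odd m")
  case True
  then show ?thesis using four_velocities_odd[OF sLRC True m(1) cd ab(1,2,5)] by blast
next
  case False
  then obtain h where h: "m = 2 * h" by blast
  then have h3: "3 \<le> h" using m by presburger
  (* If {a, b} = {c, d}, the odd velocity x also divides m x, so it can play the role of m. *)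
  have swap: "\<exists>t::real. 1/5 \<le> \<parallel>real m * real x * t + r1\<parallel> \<and> 1/5 \<le> \<parallel>real m * real y * t + r2\<parallel> \<and>
    1/5 \<le> \<parallel>real x * t + r3\<parallel> \<and> 1/5 \<le> \<parallel>real y * t + r4\<parallel>"
    if xy: "coprime x m" "coprime y m" "coprime x y" "2 \<le> x" "0 < y" for x y r1 r2 r3 r4
  proof -
    have "odd x" using xy(1) unfolding h by simp
    then have "3 \<le> x" using xy(4) by presburger
    moreover have "coprime (m * y) x" "coprime y x" using xy by (simp_all add: coprime_commute)
    \<comment> \<open>The velocities are regrouped as \<open>x * m\<close> and \<open>x * 1\<close>,
      with coprime cofactors, and the exceptional \<open>m * y\<close> and \<open>y\<close>.\<close>
    moreover have "m * y \<noteq> y" "coprime m 1" "m \<noteq> 1" "0 < m" using xy m by simp_all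
    ultimately have "\<exists>t::real. 1/5 \<le> \<parallel>real x * real m * t + r1\<parallel> \<and> 1/5 \<le> \<parallel>real x * real 1 * t + r3\<parallel> \<and>
      1/5 \<le> \<parallel>real (m * y) * t + r2\<parallel> \<and> 1/5 \<le> \<parallel>real y * t + r4\<parallel>"
      using \<open>odd x\<close> by (intro four_velocities_odd sLRC) simp_all
    then show ?thesis by (auto simp: mult.commute[of "real x" "real m"])
  qed
  consider "a \<noteq> c" "a \<noteq> d" | "b \<noteq> c" "b \<noteq> d" | "a = c" "b = d" | "a = d" "b = c"
    using ab(5) by blast
  then show ?thesis
  proof cases
    case 1
    then show ?thesis using four_velocities_even[of h c d a b s1 s2 s3 s4] sLRC h h3 cd ab by simp
  next
    case 2
    then show ?thesis using four_velocities_even[of h c d b a s1 s2 s4 s3] sLRC h h3 cd ab by auto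
  next
    case 3
    consider "2 \<le> c" | "2 \<le> d" using cd by linarith
    then show ?thesis
      using swap[of c d s1 s2 s3 s4] swap[of d c s2 s1 s4 s3] cd ab 3 by cases (auto simp: coprime_commute)
  next
    case 4
    consider "2 \<le> c" | "2 \<le> d" using cd by linarith
    then show ?thesis
      using swap[of c d s1 s2 s4 s3] swap[of d c s2 s1 s3 s4] cd ab 4 by cases (auto simp: coprime_commute)
  qed
qed

section \<open>Reduction to one or two exceptional velocities\<close>

lemma sLRC_finite:
  fixes w s :: "nat \<Rightarrow> real"
  assumes "sLRC m" "finite J" "card J = m" "inj_on w J" "\<forall>i\<in>J. 0 < w i"
  shows "\<exists>t. \<forall>i\<in>J. 1 / (real m + 1) \<le> \<parallel>w i * t + s i\<parallel>"
proof -
  obtain h where h: "bij_betw h {1..m} J"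
    using ex_bij_betw_nat_finite_1[OF assms(2)] assms(3) by blast
  then have J: "J = h ` {1..m}" and "inj_on h {1..m}" by (auto simp: bij_betw_def)
  then have "inj_on (\<lambda>i. w (h i)) {1..m}" using assms(4) comp_inj_on[of h "{1..m}" w] by (simp add: o_def)
  moreover have "\<forall>i\<in>{1..m}. 0 < w (h i)" using assms(5) J by blast
  ultimately have "sLRC_holds_for m (\<lambda>i. w (h i))" using assms(1) by (simp add: sLRC_def)
  then obtain t where "\<forall>i\<in>{1..m}. 1 / (real m + 1) \<le> \<parallel>w (h i) * t + s (h i)\<parallel>"
    unfolding sLRC_holds_for_def by meson
  then show ?thesis unfolding J by blast
qed

text \<open>As all velocities have greatest common divisor 1, the remaining one is coprime to
  \<open>d\<close> and can be rotated away alone. The bound \<open>1 / (n + 1) <= 1/4\<close> used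
  for this requires \<open>n >= 3\<close>.\<close>

lemma sLRC_holds_for_common_factor:
  fixes v :: "nat \<Rightarrow> nat"
  assumes n: "3 \<le> n" and sLRC: "sLRC (n - 1)" and inj: "inj_on v {1..n}"
    and pos: "\<forall>i\<in>{1..n}. 0 < v i" and Gcd: "Gcd (v ` {1..n}) = 1"
    and I: "I \<subseteq> {1..n}" "card I = n - 1" and d: "1 < d" "\<forall>i\<in>I. d dvd v i"
  shows "sLRC_holds_for n (\<lambda>i. real (v i))"
  unfolding sLRC_holds_for_def
proof
  fix s :: "nat \<Rightarrow> real"
  have fin: "finite I" using I(1) finite_subset by blast
  have "card ({1..n} - I) = 1" using I n fin by (simp add: card_Diff_subset)
  then obtain p where p: "{1..n} - I = {p}" by (rule card_1_singletonE)
  then have pI: "{1..n} = insert p I" using I(1) by blast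
  have "gcd (v p) d dvd v i" if "i \<in> {1..n}" for i
    using that d(2) unfolding pI by (auto intro: dvd_trans)
  then have "gcd (v p) d dvd Gcd (v ` {1..n})" by (auto intro: Gcd_greatest)
  then have cop: "coprime (v p) d" unfolding Gcd by (simp add: coprime_iff_gcd_eq_1)
  have "inj_on (\<lambda>i. real (v i)) I" 
    using inj_on_subset[OF inj I(1)] by (simp add: inj_on_def)
  moreover have "\<forall>i\<in>I. 0 < real (v i)" using pos I(1) by auto
  ultimately obtain t where t: "\<And>i. i \<in> I \<Longrightarrow> 1 / (real (n - 1) + 1) \<le> \<parallel>real (v i) * t + s i\<parallel>"
    using sLRC_finite[OF sLRC fin I(2), of "\<lambda>i. real (v i)" s] by blast
  have e: "1 / (real n + 1) \<le> 1 / 4" "1 / (real n + 1) \<le> 1 / (real (n - 1) + 1)"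
    using n by (simp_all add: field_simps)
  obtain k where k: "1 / (real n + 1) \<le> \<parallel>(real (v p) * t + s p) + real k * v p / d\<parallel>"
    using ex_far_rotation_quarter[OF cop _ e(1)] d(1) by force
  have "1 / (real n + 1) \<le> \<parallel>real (v i) * (t + k / d) + s i\<parallel>" if "i \<in> {1..n}" for i
  proof (cases "i = p")
    case True
    then show ?thesis using k by (simp add: algebra_simps)
  next
    case False
    then have "i \<in> I" using that pI by blast
    then obtain c where c: "v i = d * c" using d(2) by blast
    have "\<parallel>real (v i) * (t + k / d) + s i\<parallel> = \<parallel>real (v i) * t + s i\<parallel>"
      using d(1) by (intro dist_nearest_int_eqI[of _ _ "int (c * k)"]) (simp add: c field_simps)
    then show ?thesis using t[OF \<open>i \<in> I\<close>] e(2) by linarith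
  qed
  then show "\<exists>t. \<forall>i\<in>{1..n}. 1 / (real n + 1) \<le> \<parallel>real (v i) * t + s i\<parallel>" by blast
qed

lemma sLRC_holds_for_coprime_pair:
  fixes v :: "nat \<Rightarrow> nat"
  assumes sLRC: "sLRC (n - 1)" and inj: "inj_on v {1..n}" and pos: "\<forall>i\<in>{1..n}. 0 < v i"
    and I: "{1..n} = insert p (insert q I)" "p \<noteq> q" "p \<notin> I" "q \<notin> I"
    and m: "0 < m" "2 * m \<le> (n + 1) * ((m - 1) div 2)" "\<forall>i\<in>I. m dvd v i"
    and cop: "coprime (v p) m" "coprime (v q) m"
  shows "sLRC_holds_for n (\<lambda>i. real (v i))"
  unfolding sLRC_holds_for_def
proof
  fix s :: "nat \<Rightarrow> real"
  \<comment> \<open>Adding \<open>p\<close> yields the \<open>n - 1\<close> velocities of the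
    hypothesis; the rotation repositions \<open>p\<close> afterwards.\<close>
  define J where "J = insert p I"
  have J: "J = {1..n} - {q}" using I by (auto simp: J_def)
  have q: "q \<in> {1..n}" using I(1) by blast
  have card: "card J = n - 1" using q by (simp add: J)
  have sub: "J \<subseteq> {1..n}" unfolding J by (rule Diff_subset)
  have "inj_on (\<lambda>i. real (v i)) J"
    using inj_on_subset[OF inj sub] by (simp add: inj_on_def)
  moreover have "\<forall>i\<in>J. 0 < real (v i)" using pos sub by auto
  ultimately obtain t where t: "\<And>i. i \<in> J \<Longrightarrow> 1 / (real (n - 1) + 1) \<le> \<parallel>real (v i) * t + s i\<parallel>"
    using sLRC_finite[OF sLRC finite_subset[OF sub] card, of "\<lambda>i. real (v i)" s] by auto
  have e: "1 / (real n + 1) \<le> 1 / (real (n - 1) + 1)" by (simp add: field_simps)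
  obtain k where k: "1 / (real n + 1) \<le> \<parallel>(real (v p) * t + s p) + real k * v p / m\<parallel>"
    "1 / (real n + 1) \<le> \<parallel>(real (v q) * t + s q) + real k * v q / m\<parallel>"
    using ex_far_rotation_pair_count[OF cop m(1,2)] by blast
  have "1 / (real n + 1) \<le> \<parallel>real (v i) * (t + k / m) + s i\<parallel>" if i: "i \<in> {1..n}" for i
  proof -
    consider "i = p" | "i = q" | "i \<in> I" using i[unfolded I(1)] by blast
    then show ?thesis
    proof cases
      case 1
      then show ?thesis using k(1) by (simp add: algebra_simps)
    next
      case 2
      then show ?thesis using k(2) by (simp add: algebra_simps)
    next
      case 3
      then obtain c where c: "v i = m * c" using m(3) by blast
      have "\<parallel>real (v i) * (t + k / m) + s i\<parallel> = \<parallel>real (v i) * t + s i\<parallel>"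
        using m(1) by (intro dist_nearest_int_eqI[of _ _ "int (c * k)"]) (simp add: c field_simps)
      then show ?thesis using t[of i] 3 e by (simp add: J_def)
    qed
  qed
  then show "\<exists>t. \<forall>i\<in>{1..n}. 1 / (real n + 1) \<le> \<parallel>real (v i) * t + s i\<parallel>" by blast
qed

lemma sLRC_holds_for_two:
  fixes v :: "nat \<Rightarrow> nat"
  assumes inj: "inj_on v {1..2}" and pos: "\<forall>i\<in>{1..2}. 0 < v i" and Gcd: "Gcd (v ` {1..2}) = 1"
  shows "sLRC_holds_for 2 (\<lambda>i. real (v i))"
  unfolding sLRC_holds_for_def
proof
  fix s :: "nat \<Rightarrow> real"
  have I: "{1..2::nat} = {1, 2}" by auto
  have v: "v 1 \<noteq> v 2" "0 < v 1" "0 < v 2" using inj pos unfolding I by auto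
  have cop: "coprime (v 1) (v 2)" using Gcd unfolding I by (simp add: coprime_iff_gcd_eq_1)
  \<comment> \<open>Distinct positive velocities are not both 1, so one can serve as the
    modulus.\<close>
  consider "2 \<le> v 1" | "2 \<le> v 2" using v by linarith
  then have "\<exists>t::real. 1/3 \<le> \<parallel>real (v 1) * t + s 1\<parallel> \<and> 1/3 \<le> \<parallel>real (v 2) * t + s 2\<parallel>"
    using two_velocities[of "v 1" "v 2" "s 1" "s 2"] two_velocities[of "v 2" "v 1" "s 2" "s 1"] cop v
    by cases (auto simp: coprime_commute)
  then show "\<exists>t. \<forall>i\<in>{1..2}. 1 / (real 2 + 1) \<le> \<parallel>real (v i) * t + s i\<parallel>"
    unfolding I by simp
qed

text \<open>If an exceptional velocity shares a factor with \<open>m\<close>, then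
  \<open>n - 1\<close> velocities have a common factor. Otherwise both are coprime to
  \<open>m\<close>, and the count decides for \<open>n >= 5\<close>, leaving \<open>n = 3\<close>
  and \<open>n = 4\<close>.\<close>

lemma sLRC_holds_for_Gcd:
  fixes v :: "nat \<Rightarrow> nat"
  assumes n: "3 \<le> n" and sLRC: "sLRC (n - 1)" and inj: "inj_on v {1..n}"
    and pos: "\<forall>i\<in>{1..n}. 0 < v i" and Gcd: "Gcd (v ` {1..n}) = 1"
    and I: "I \<subseteq> {1..n}" "card I = n - 2"
    and m: "Gcd (v ` I) \<notin> {1, 2}" "Gcd (v ` I) \<noteq> 4 \<or> 7 \<le> n"
  shows "sLRC_holds_for n (\<lambda>i. real (v i))"
proof -
  define m where "m = Gcd (v ` I)"
  have fin: "finite I" using I(1) finite_subset by blast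
  have mI: "\<forall>i\<in>I. m dvd v i" by (auto simp: m_def)
  obtain i where i: "i \<in> I" using I(2) n by fastforce
  have "0 < v i" using i I(1) pos by blast
  then have "m \<noteq> 0" using bspec[OF mI i] by (metis dvd_0_left_iff less_irrefl)
  moreover have "m \<noteq> 1" "m \<noteq> 2" using m(1) by (simp_all add: m_def)
  ultimately have m3: "3 \<le> m" by linarith
  have "card ({1..n} - I) = 2" using I n fin by (simp add: card_Diff_subset)
  then obtain p q where pq: "{1..n} - I = {p, q}" "p \<noteq> q" by (auto simp: card_2_iff)
  then have split: "{1..n} = insert p (insert q I)" "p \<notin> I" "q \<notin> I" using I(1) by blast+
  have ranges: "p \<in> {1..n}" "q \<in> {1..n}" using split by blast+
  have ne: "v x \<noteq> v y" if "x \<in> {1..n}" "y \<in> {1..n}" "x \<noteq> y" for x y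
    using inj_onD[OF inj _ that(1,2)] that(3) by blast
  have iI: "i \<in> {1..n}" using i I(1) by blast
  have shared: ?thesis if "r \<in> {p, q}" "\<not> coprime (v r) m" for r
  proof (rule sLRC_holds_for_common_factor[OF n sLRC inj pos Gcd])
    show "insert r I \<subseteq> {1..n}" "card (insert r I) = n - 1"
      using that(1) split I fin n by auto
    have "gcd (v r) m \<noteq> 0" "gcd (v r) m \<noteq> 1" using m3 that(2) by (auto simp: coprime_iff_gcd_eq_1)
    then show "1 < gcd (v r) m" by linarith
    show "\<forall>i\<in>insert r I. gcd (v r) m dvd v i" using mI by (auto intro: dvd_trans)
  qed
  show ?thesis
  proof (cases "coprime (v p) m \<and> coprime (v q) m")
    case False
    then show ?thesis using shared by blast
  next
    case True
    then have cop: "coprime (v p) m" "coprime (v q) m" by auto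
    consider "5 \<le> n" | "n = 3" | "n = 4" using n by linarith
    then show ?thesis
    proof cases
      case 1
      \<comment> \<open>With factor 6 the inequality holds for every \<open>m >= 3\<close> except 4;
        for \<open>m = 4\<close> it reads \<open>8 <= n + 1\<close>, whence the bound 7.\<close>
      have "2 * m \<le> (n + 1) * ((m - 1) div 2)"
      proof (cases "m = 4")
        case True
        then show ?thesis using m(2) by (auto simp: m_def)
      next
        case False
        then have "2 * m \<le> 6 * ((m - 1) div 2)" using m3 by presburger
        also have "\<dots> \<le> (n + 1) * ((m - 1) div 2)" using 1 by (intro mult_le_mono1) simp
        finally show ?thesis .
      qed
      then show ?thesis
        using sLRC_holds_for_coprime_pair[OF sLRC inj pos split(1) pq(2) split(2,3) _ _ mI cop] m3 by simp
    next
      case 2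
      then have "card I = 1" using I(2) by simp
      then have Ii: "I = {i}" using i by (auto simp: card_1_singleton_iff)
      have mi: "m = v i" by (simp add: m_def Ii)
      show ?thesis
      \<comment> \<open>\<open>m\<close> is itself a velocity coprime to the other two. If those
        share a factor, the case of \<open>n - 1\<close> velocities applies again; otherwise all
        three are pairwise coprime.\<close>
      proof (cases "coprime (v p) (v q)")
        case False
        show ?thesis
        proof (rule sLRC_holds_for_common_factor[OF n sLRC inj pos Gcd])
          show "{p, q} \<subseteq> {1..n}" "card {p, q} = n - 1" using ranges pq 2 by auto
          have "gcd (v p) (v q) \<noteq> 0" "gcd (v p) (v q) \<noteq> 1"
            using False pos ranges by (auto simp: coprime_iff_gcd_eq_1)
          then show "1 < gcd (v p) (v q)" by linarith
          show "\<forall>i\<in>{p, q}. gcd (v p) (v q) dvd v i" by auto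
        qed
      next
        case True
        have "v p \<noteq> v q" "v p \<noteq> v i" "v q \<noteq> v i"
          using ne ranges iI pq(2) split(2,3) i by metis+
        moreover have "0 < v p" "0 < v q" using pos ranges by auto
        ultimately have "\<exists>t::real. 1/4 \<le> \<parallel>v p * t + s p\<parallel> \<and> 1/4 \<le> \<parallel>v q * t + s q\<parallel> \<and> 1/4 \<le> \<parallel>v i * t + s i\<parallel>"
          for s :: "nat \<Rightarrow> real"
          using three_velocities cop True \<open>0 < v i\<close> unfolding mi by blast
        then show ?thesis
          unfolding sLRC_holds_for_def split(1) Ii using 2 by simp
      qed
    next
      case 3
      then have "card I = 2" using I(2) by simp
      then obtain j where Ij: "I = {i, j}" "i \<noteq> j" using i by (auto simp: card_2_iff)
      have mg: "m = gcd (v i) (v j)" by (simp add: m_def Ij)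
      define c where "c = v i div m"
      define d where "d = v j div m"
      have vi: "v i = m * c" "v j = m * d" by (simp_all add: c_def d_def mg)
      \<comment> \<open>The cofactors are coprime because \<open>m\<close> is the full greatest
        common divisor.\<close>
      have "coprime c d" unfolding c_def d_def mg using \<open>0 < v i\<close> by (intro div_gcd_coprime) simp
      moreover have "j \<in> {1..n}" using Ij(1) I(1) by blast
      then have "0 < v j" "v i \<noteq> v j" using pos ne[OF iI _ Ij(2)] by blast+
      moreover have "v p \<noteq> v q" using ne[OF ranges pq(2)] .
      moreover have "0 < v p" "0 < v q" using pos ranges by blast+
      moreover have "m \<noteq> 4" using m(2) 3 by (auto simp: m_def)
      moreover have "sLRC 3" using sLRC 3 by simp
      ultimately have "\<exists>t::real. 1/5 \<le> \<parallel>real m * real c * t + s i\<parallel> \<and> 1/5 \<le> \<parallel>real m * real d * t + s j\<parallel> \<and>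
          1/5 \<le> \<parallel>real (v p) * t + s p\<parallel> \<and> 1/5 \<le> \<parallel>real (v q) * t + s q\<parallel>" for s :: "nat \<Rightarrow> real"
        using cop m3 \<open>0 < v i\<close> unfolding vi by (intro four_velocities) auto
      then have "\<exists>t::real. 1/5 \<le> \<parallel>real (v i) * t + s i\<parallel> \<and> 1/5 \<le> \<parallel>real (v j) * t + s j\<parallel> \<and>
          1/5 \<le> \<parallel>real (v p) * t + s p\<parallel> \<and> 1/5 \<le> \<parallel>real (v q) * t + s q\<parallel>" for s :: "nat \<Rightarrow> real"
        by (simp add: vi)
      then have "\<exists>t::real. \<forall>k\<in>{p, q, i, j}. 1/5 \<le> \<parallel>real (v k) * t + s k\<parallel>" for s :: "nat \<Rightarrow> real"
        by fastforce
      moreover have "1 / (real n + 1) = 1/5" using 3 by simp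
      ultimately show ?thesis
        unfolding sLRC_holds_for_def split(1) Ij(1) by simp
    qed
  qed
qed

theorem theorem6:
  fixes n :: nat and v :: "nat \<Rightarrow> nat"
  assumes "n \<ge> 2"
    and "sLRC (n - 1)"
    and "inj_on v {1..n}"
    and "\<forall>i\<in>{1..n}. 0 < v i"
    and "Gcd (v ` {1..n}) = 1"
    and "(\<exists>I\<subseteq>{1..n}. card I = n - 1 \<and> (\<exists>d>1. \<forall>i\<in>I. d dvd v i)) \<or>
      (n \<ge> 3 \<and> (\<exists>I\<subseteq>{1..n}. card I = n - 2 \<and>
         (Gcd (v ` I) \<notin> {1, 2, 4} \<or> (n \<ge> 7 \<and> Gcd (v ` I) \<notin> {1, 2}))))"
  shows "sLRC_holds_for n (\<lambda>i. real (v i))"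
proof (cases "n = 2")
  case True
  then show ?thesis using sLRC_holds_for_two assms(3-5) by blast
next
  case False
  then have n: "3 \<le> n" using assms(1) by linarith
  from assms(6) show ?thesis
  proof
    assume "\<exists>I\<subseteq>{1..n}. card I = n - 1 \<and> (\<exists>d>1. \<forall>i\<in>I. d dvd v i)"
    then show ?thesis using sLRC_holds_for_common_factor[OF n assms(2-5)] by blast
  next
    assume "n \<ge> 3 \<and> (\<exists>I\<subseteq>{1..n}. card I = n - 2 \<and>
      (Gcd (v ` I) \<notin> {1, 2, 4} \<or> (n \<ge> 7 \<and> Gcd (v ` I) \<notin> {1, 2})))"
    then show ?thesis using sLRC_holds_for_Gcd[OF n assms(2-5)] by blast
  qed
qed

end
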